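(* For integers $c\ge 3$, $r\ge 1$ and $n\ge 1$ let $M_{c,r}(n)$ be the maximum possible chromatic number of a graph on $n$ vertices in which every $r$-ball is $c$-colorable. There exist an absolute constant $a>0$ and, for each $c\ge 3$ and $r\ge 1$, a constant $b_{c,r}>0$ such that for every fixed $c\ge 3$ and $r\ge 1$ and all sufficiently large $n$, $$a\,\frac{n^{\frac{1}{r+1}}}{\log n}\;\le\; M_{c,r}(n)\;\le\; b_{c,r}\, n^{\frac{1}{r+1}} .$$
   Context: Graphs are finite, simple and undirected. For a graph $G=(V,E)$, $v\in V$ and a positive integer $r$, the $r$-ball $U_r(v,G)$ is the subgraph of $G$ induced on all vertices at graph distance at most $r$ from $v$. $\chi(G)$ denotes the chromatic number. $\log$ is the natural logarithm. *)

theory Defs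
  imports
    "Graph_Theory.Pair_Digraph"
    "Graph_Theory.Digraph_Component"
    "Graph_Theory.Shortest_Path"
begin

text \<open>
  A finite simple undirected graph is a \<open>pair_graph\<close>: a finite loopless digraph without
  parallel arcs whose arc relation is symmetric, so that each edge is represented by its two
  orientations.
\<close>

definition graph_dist :: "('a, 'b) pre_digraph \<Rightarrow> 'a \<Rightarrow> 'a \<Rightarrow> ereal" where
  "graph_dist G u v = wf_digraph.\<mu> G (\<lambda>_. 1) u v"

definition r_ball :: "nat \<Rightarrow> 'a \<Rightarrow> ('a, 'b) pre_digraph \<Rightarrow> ('a, 'b) pre_digraph" where
  "r_ball r v G = G \<restriction> {w \<in> verts G. graph_dist G v w \<le> ereal (real r)}"

definition proper_coloring :: "('a, 'b) pre_digraph \<Rightarrow> ('a \<Rightarrow> nat) \<Rightarrow> bool" where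
  "proper_coloring G f \<longleftrightarrow> (\<forall>(u, v) \<in> arcs_ends G. f u \<noteq> f v)"

definition colorable :: "('a, 'b) pre_digraph \<Rightarrow> nat \<Rightarrow> bool" where
  "colorable G k \<longleftrightarrow> (\<exists>f. f ` verts G \<subseteq> {..<k} \<and> proper_coloring G f)"

definition chromatic_number :: "('a, 'b) pre_digraph \<Rightarrow> nat" where
  "chromatic_number G = (LEAST k. colorable G k)"

definition locally_colorable :: "nat \<Rightarrow> nat \<Rightarrow> ('a, 'b) pre_digraph \<Rightarrow> bool" where
  "locally_colorable c r G \<longleftrightarrow> (\<forall>v \<in> verts G. colorable (r_ball r v G) c)"

text \<open>
  Graphs with natural numbers as vertices represent all finite graphs up to isomorphism; see
  \<open>chromatic_number_le_max\<close> below.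
\<close>

definition max_chromatic :: "nat \<Rightarrow> nat \<Rightarrow> nat \<Rightarrow> nat" where
  "max_chromatic c r n =
    Max {chromatic_number (with_proj G) | G :: nat pair_pre_digraph.
      pair_graph G \<and> card (pverts G) = n \<and> locally_colorable c r (with_proj G)}"


lemma (in pair_wf_digraph) awalk_iff_relpow:
  assumes "u \<in> pverts G"
  shows "(\<exists>p. awalk u p v \<and> length p = k) \<longleftrightarrow> (u, v) \<in> parcs G ^^ k"
  using assms
proof (induction k arbitrary: u)
  case 0
  then show ?case by (auto simp: awalk_def)
next
  case (Suc k)
  have "(\<exists>p. awalk u p v \<and> length p = Suc k) \<longleftrightarrow>
      (\<exists>e p. awalk u (e # p) v \<and> length p = k)"
    by (metis length_Suc_conv)
  also have "\<dots> \<longleftrightarrow> (\<exists>w. (u, w) \<in> parcs G \<and> (\<exists>p. awalk w p v \<and> length p = k))"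
    by (force simp: awalk_Cons_iff)
  also have "\<dots> \<longleftrightarrow> (\<exists>w. (u, w) \<in> parcs G \<and> (w, v) \<in> parcs G ^^ k)"
    using Suc.IH in_arcsD2 by blast
  also have "\<dots> \<longleftrightarrow> (u, v) \<in> parcs G ^^ Suc k"
    by (meson relpow_Suc_D2 relpow_Suc_I2)
  finally show ?case .
qed

lemma (in pair_wf_digraph) graph_dist_le_iff:
  assumes "u \<in> pverts G"
  shows "graph_dist (with_proj G) u v \<le> ereal (real r) \<longleftrightarrow> (\<exists>k\<le>r. (u, v) \<in> parcs G ^^ k)"
proof -
  have cost: "awalk_cost (\<lambda>_. 1) p = real (length p)" for p :: "('a \<times> 'a) awalk"
    by (induction p) auto
  have "graph_dist (with_proj G) u v \<le> ereal (real r) \<longleftrightarrow>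
      (\<exists>p. awalk u p v \<and> length p \<le> r)" (is "?L \<longleftrightarrow> ?R")
  proof
    assume ?L
    then have "graph_dist (with_proj G) u v < ereal (real r + 1)"
      by (rule le_less_trans) simp
    then show ?R
      unfolding graph_dist_def \<mu>_def cost INF_less_iff by force
  next
    assume ?R
    then show ?L
      unfolding graph_dist_def \<mu>_def cost by (auto intro!: INF_lower2)
  qed
  also have "\<dots> \<longleftrightarrow> (\<exists>k\<le>r. (u, v) \<in> parcs G ^^ k)"
    unfolding awalk_iff_relpow[OF assms, symmetric] by blast
  finally show ?thesis .
qed

lemma colorable_r_ball_iff:
  assumes "pair_wf_digraph G" "v \<in> pverts G"
  shows "colorable (r_ball r v (with_proj G)) c \<longleftrightarrow>
    (let B = {w. \<exists>k\<le>r. (v, w) \<in> parcs G ^^ k} in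
      \<exists>f. f ` B \<subseteq> {..<c} \<and> (\<forall>x\<in>B. \<forall>y\<in>B. (x, y) \<in> parcs G \<longrightarrow> f x \<noteq> (f y :: nat)))"
proof -
  interpret pair_wf_digraph G by fact
  define B where "B = {w. \<exists>k\<le>r. (v, w) \<in> parcs G ^^ k}"
  have mem: "w \<in> pverts G" if "(v, w) \<in> parcs G ^^ k" for w k
    using that assms(2) by (cases k) (auto dest: in_arcsD2)
  have B: "r_ball r v (with_proj G) = with_proj G \<restriction> B"
    unfolding r_ball_def B_def with_proj_simps graph_dist_le_iff[OF assms(2)]
    using mem by (intro arg_cong2[where f = induce_subgraph] refl) auto
  have "arcs_ends (with_proj G \<restriction> B) = {(x, y) \<in> parcs G. x \<in> B \<and> y \<in> B}"
    by (force simp: arcs_ends_def arc_to_ends_def)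
  then show ?thesis
    unfolding B colorable_def proper_coloring_def Let_def B_def[symmetric]
    by (auto simp: image_subset_iff)
qed

lemma colorable_card:
  assumes "pair_graph G"
  shows "colorable (with_proj G) (card (pverts G))"
proof -
  interpret pair_graph G by fact
  obtain f where "bij_betw f (pverts G) {..<card (pverts G)}"
    using ex_bij_betw_finite_nat[OF pair_finite_verts] by (auto simp: atLeast0LessThan)
  then have f: "inj_on f (pverts G)" "f ` pverts G = {..<card (pverts G)}"
    by (auto simp: bij_betw_def)
  have "proper_coloring (with_proj G) f"
    unfolding proper_coloring_def with_proj_simps
    using f(1) no_loops' in_arcsD1 in_arcsD2 by (fastforce dest: inj_onD)
  then show ?thesis using f(2) by (auto simp: colorable_def)
qed

lemma chromatic_number_le_card:
  "pair_graph G \<Longrightarrow> chromatic_number (with_proj G) \<le> card (pverts G)"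
  unfolding chromatic_number_def by (intro Least_le colorable_card)

lemma finite_chromatic_numbers:
  "finite {chromatic_number (with_proj G) | G :: nat pair_pre_digraph.
     pair_graph G \<and> card (pverts G) = n \<and> locally_colorable c r (with_proj G)}"
  by (rule finite_subset[of _ "{..n}"]) (auto dest: chromatic_number_le_card)

lemma max_chromatic_attained:
  assumes "c \<ge> 1"
  obtains G :: "nat pair_pre_digraph" where
    "pair_graph G" "card (pverts G) = n" "locally_colorable c r (with_proj G)"
    "chromatic_number (with_proj G) = max_chromatic c r n"
proof -
  let ?S = "{chromatic_number (with_proj G) | G :: nat pair_pre_digraph.
     pair_graph G \<and> card (pverts G) = n \<and> locally_colorable c r (with_proj G)}"
  define E :: "nat pair_pre_digraph" where "E = \<lparr>pverts = {..<n}, parcs = {}\<rparr>"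
  have E: "pair_graph E"
    by unfold_locales (auto simp: E_def symmetric_def with_proj_def arcs_ends_def intro: symI)
  then interpret E: pair_graph E .
  have "locally_colorable c r (with_proj E)"
    unfolding locally_colorable_def with_proj_simps
  proof
    fix v assume "v \<in> pverts E"
    then show "colorable (r_ball r v (with_proj E)) c"
      unfolding colorable_r_ball_iff[OF E.pair_wf_digraph \<open>v \<in> pverts E\<close>]
      using assms by (auto simp: Let_def E_def intro!: exI[of _ "\<lambda>_. 0"])
  qed
  with E have "chromatic_number (with_proj E) \<in> ?S"
    by (auto simp: E_def)
  then have "Max ?S \<in> ?S"
    using finite_chromatic_numbers by (intro Max_in) auto
  then show ?thesis
    using that unfolding max_chromatic_def by auto
qed

lemma relpow_map_prod_inj:
  assumes "inj_on f A" "R \<subseteq> A \<times> A" "u \<in> A" "w \<in> A"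
  shows "(f u, f w) \<in> (map_prod f f ` R) ^^ k \<longleftrightarrow> (u, w) \<in> R ^^ k"
  using assms(4)
proof (induction k arbitrary: w)
  case 0
  then show ?case using assms by (auto dest: inj_onD)
next
  case (Suc k)
  show ?case
  proof
    assume "(f u, f w) \<in> (map_prod f f ` R) ^^ Suc k"
    then obtain y where y: "(f u, y) \<in> (map_prod f f ` R) ^^ k" "(y, f w) \<in> map_prod f f ` R"
      by (meson relpow_Suc_E)
    then obtain x w' where x: "y = f x" "f w = f w'" "(x, w') \<in> R" by auto
    then have "w' = w" "x \<in> A" using assms Suc.prems by (auto dest: inj_onD)
    then show "(u, w) \<in> R ^^ Suc k" using Suc.IH[of x] x y by auto
  next
    assume "(u, w) \<in> R ^^ Suc k"
    then obtain x where x: "(u, x) \<in> R ^^ k" "(x, w) \<in> R" by auto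
    then have "x \<in> A" using assms by auto
    then have "(f u, f x) \<in> (map_prod f f ` R) ^^ k" using Suc.IH x by auto
    moreover have "(f x, f w) \<in> map_prod f f ` R" using x by force
    ultimately show "(f u, f w) \<in> (map_prod f f ` R) ^^ Suc k" by (rule relpow_Suc_I)
  qed
qed

lemma chromatic_number_le_max:
  fixes G :: "'a pair_pre_digraph"
  assumes G: "pair_graph G" and loc: "locally_colorable c r (with_proj G)"
  shows "chromatic_number (with_proj G) \<le> max_chromatic c r (card (pverts G))"
proof -
  interpret G: pair_graph G by fact
  obtain f :: "'a \<Rightarrow> nat" where f: "inj_on f (pverts G)"
    using G.pair_finite_verts finite_imp_inj_to_nat_seg by blast
  define h where "h = inv_into (pverts G) f"
  have h: "h (f x) = x" if "x \<in> pverts G" for x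
    using f that by (simp add: h_def)
  define H where "H = \<lparr>pverts = f ` pverts G, parcs = map_prod f f ` parcs G\<rparr>"
  have arcsD: "x \<in> pverts G \<and> y \<in> pverts G" if "(x, y) \<in> parcs G" for x y
    using that G.in_arcsD1 G.in_arcsD2 by blast
  have H: "pair_graph H"
  proof unfold_locales
    show "symmetric (with_proj H)"
      unfolding symmetric_def
    proof (rule symI)
      fix a b assume "(a, b) \<in> arcs_ends (with_proj H)"
      then obtain x y where "a = f x" "b = f y" "(x, y) \<in> parcs G"
        by (auto simp: H_def)
      then show "(b, a) \<in> arcs_ends (with_proj H)"
        using G.arcs_symmetric by (force simp: H_def)
    qed
  next
    fix e assume "e \<in> parcs H"
    then show "fst e \<noteq> snd e"
      using f arcsD G.no_loops' by (fastforce simp: H_def dest: inj_onD)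
  qed (use G.pair_finite_verts G.pair_finite_arcs arcsD in \<open>auto simp: H_def\<close>)
  interpret H: pair_graph H by fact
  have locH: "locally_colorable c r (with_proj H)"
    unfolding locally_colorable_def with_proj_simps
  proof
    fix v assume v: "v \<in> pverts H"
    then obtain u where u: "u \<in> pverts G" "v = f u" by (auto simp: H_def)
    define B where "B = {w. \<exists>k\<le>r. (u, w) \<in> parcs G ^^ k}"
    define C where "C = {w. \<exists>k\<le>r. (v, w) \<in> parcs H ^^ k}"
    obtain g where g: "g ` B \<subseteq> {..<c}"
      "\<forall>x\<in>B. \<forall>y\<in>B. (x, y) \<in> parcs G \<longrightarrow> g x \<noteq> (g y :: nat)"
      using loc u(1) colorable_r_ball_iff[OF G.pair_wf_digraph u(1), of r c]
      unfolding locally_colorable_def with_proj_simps Let_def B_def[symmetric] by blast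
    have C: "h w \<in> B \<and> h w \<in> pverts G \<and> f (h w) = w" if w: "w \<in> C" for w
    proof -
      obtain k where k: "k \<le> r" "(v, w) \<in> parcs H ^^ k" using w by (auto simp: C_def)
      then have "w \<in> pverts H" using v by (cases k) (auto dest: H.in_arcsD2)
      then obtain x where x: "x \<in> pverts G" "w = f x" by (auto simp: H_def)
      have "(u, x) \<in> parcs G ^^ k"
        using k(2) relpow_map_prod_inj[OF f _ u(1) x(1), of "parcs G" k] arcsD x u
        by (fastforce simp: H_def)
      then show ?thesis using k x h by (auto simp: B_def)
    qed
    have "(h x, h y) \<in> parcs G" if "(x, y) \<in> parcs H" for x y
      using that h arcsD by (auto simp: H_def)
    then have "(g \<circ> h) ` C \<subseteq> {..<c} \<and>
        (\<forall>x\<in>C. \<forall>y\<in>C. (x, y) \<in> parcs H \<longrightarrow> (g \<circ> h) x \<noteq> (g \<circ> h) y)"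
      using C g by (simp add: image_subset_iff)
    then show "colorable (r_ball r v (with_proj H)) c"
      unfolding colorable_r_ball_iff[OF H.pair_wf_digraph v] Let_def C_def[symmetric] by blast
  qed
  have card: "card (pverts H) = card (pverts G)"
    by (simp add: H_def card_image f)
  have "chromatic_number (with_proj G) \<le> chromatic_number (with_proj H)"
  proof -
    have "colorable (with_proj H) (chromatic_number (with_proj H))"
      unfolding chromatic_number_def by (rule LeastI) (rule colorable_card[OF H])
    then obtain g where g: "g ` pverts H \<subseteq> {..<chromatic_number (with_proj H)}"
      "proper_coloring (with_proj H) g" by (auto simp: colorable_def)
    then have "proper_coloring (with_proj G) (g \<circ> f)"
      by (auto simp: proper_coloring_def H_def)
    moreover have "(g \<circ> f) ` pverts G \<subseteq> {..<chromatic_number (with_proj H)}"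
      using g(1) by (auto simp: H_def)
    ultimately show ?thesis
      unfolding chromatic_number_def[of "with_proj G"]
      by (intro Least_le) (unfold colorable_def with_proj_simps, blast)
  qed
  also have "\<dots> \<le> max_chromatic c r (card (pverts G))"
    unfolding max_chromatic_def
    by (intro Max_ge finite_chromatic_numbers) (use H locH card in auto)
  finally show ?thesis .
qed

end

theory Submission
  imports Defs
begin

text \<open>
  Upper bound. Let a graph on \<open>n\<close> vertices have \<open>c\<close>-colorable \<open>r\<close>-balls and put \<open>K = n^(1/(r+1))\<close>.
  Around every vertex some ball of radius \<open>i \<le> r\<close> grows by a factor at most \<open>K\<close> when its radius is
  increased by one, since otherwise the ball of radius \<open>r + 1\<close> would have more than \<open>n\<close> vertices.
  Carving out such balls one after the other, and discarding the boundary of each, leaves a union of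
  pairwise non-adjacent \<open>c\<close>-colorable sets with at least \<open>n / K\<close> vertices in total
  (\<open>carve_colorable_subset\<close>). It is colored with \<open>c\<close> colors, and the remaining vertices
  are colored recursively with new ones. Each round lowers \<open>n^(1/(r+1))\<close> by at least \<open>1/(r+1)\<close>, so
  \<open>c (r + 1) n^(1/(r+1))\<close> colors are enough (\<open>global_coloring_from_local\<close>).

  Lower bound. In the random graph \<open>G(n, p)\<close> with \<open>d = n p = n^(1/(r+1)) / 1296\<close>, the \<open>r\<close>-ball around a
  fixed vertex is \<open>3\<close>-colorable with probability at least \<open>3/4\<close>. Indeed its expected size is at most
  \<open>(1 + d)^r\<close>. If it is not \<open>3\<close>-colorable, it contains a nonempty set \<open>H\<close> in which every vertex has at
  least three neighbors within \<open>H\<close>. Take the breadth-first search tree of the ball, and let \<open>A\<close> be the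
  set of those vertices of \<open>H\<close> that have no proper descendant in \<open>H\<close>. All of \<open>H\<close> consists of ancestors of
  \<open>A\<close>, of which there are at most \<open>(r + 1) |A|\<close>, and a vertex of \<open>A\<close> has at most one tree edge into \<open>H\<close>;
  hence there are at least \<open>|A|\<close> non-tree edges between \<open>A\<close> and its ancestors
  (\<open>non_three_colorable_witness\<close>). Conditioned on the tree, given non-tree edges are present with
  probability at most \<open>p\<close> each, because deleting a non-tree edge does not change the tree
  (\<open>bfs_remove\<close>, \<open>Pr_remove\<close>). A union bound over \<open>A\<close> and the \<open>|A|\<close> non-tree edges gives a geometric
  series (\<open>Pr_not_three_colorable_given_bfs\<close>).

  Independent sets of \<open>G(n, p)\<close> have \<open>O(ln n / p)\<close> vertices with high probability. So some graph has this
  property and more than \<open>n / 2\<close> vertices with a \<open>3\<close>-colorable \<open>r\<close>-ball; isolating all other vertices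
  makes every \<open>r\<close>-ball \<open>3\<close>-colorable, and the chromatic number is at least a constant times
  \<open>n p / ln n\<close>.
\<close>

section \<open>Colorings and balls\<close>

text \<open>
  The subgraph of \<open>R\<close> induced on \<open>S\<close> is \<open>c\<close>-colorable. Graphs are given here by their adjacency
  relation alone.
\<close>

definition col_on :: "('a \<times> 'a) set \<Rightarrow> 'a set \<Rightarrow> nat \<Rightarrow> bool" where
  "col_on R S c \<longleftrightarrow> (\<exists>f. f ` S \<subseteq> {..<c} \<and> (\<forall>x\<in>S. \<forall>y\<in>S. (x, y) \<in> R \<longrightarrow> f x \<noteq> f y))"

text \<open>The vertices that are reached from \<open>v\<close> by a walk of length at most \<open>i\<close>.\<close>

definition nball :: "('a \<times> 'a) set \<Rightarrow> nat \<Rightarrow> 'a \<Rightarrow> 'a set" where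
  "nball R i v = {w. \<exists>k\<le>i. (v, w) \<in> R ^^ k}"

lemma col_onE:
  assumes "col_on R S c"
  obtains f where "f ` S \<subseteq> {..<c}" "\<forall>x\<in>S. \<forall>y\<in>S. (x, y) \<in> R \<longrightarrow> f x \<noteq> f y"
  using assms unfolding col_on_def by blast

lemma col_on_mono:
  assumes "col_on R S c" "T \<subseteq> S" "Q \<inter> T \<times> T \<subseteq> R" "c \<le> d"
  shows "col_on Q T d"
proof -
  obtain f where "f ` S \<subseteq> {..<c}" "\<forall>x\<in>S. \<forall>y\<in>S. (x, y) \<in> R \<longrightarrow> f x \<noteq> f y"
    using assms(1) unfolding col_on_def by blast
  then have "f ` T \<subseteq> {..<d} \<and> (\<forall>x\<in>T. \<forall>y\<in>T. (x, y) \<in> Q \<longrightarrow> f x \<noteq> f y)"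
    using assms(2-4) by (intro conjI ballI impI) (force, blast)
  then show ?thesis unfolding col_on_def by blast
qed

lemma nball_0 [simp]: "nball R 0 v = {v}"
  by (auto simp: nball_def)

lemma nball_Suc: "nball R (Suc i) v = nball R i v \<union> R `` nball R i v"
proof (intro set_eqI iffI)
  fix w assume "w \<in> nball R (Suc i) v"
  then obtain k where k: "k \<le> Suc i" "(v, w) \<in> R ^^ k" by (auto simp: nball_def)
  show "w \<in> nball R i v \<union> R `` nball R i v"
  proof (cases k)
    case 0
    then show ?thesis using k by (auto simp: nball_def)
  next
    case (Suc j)
    then obtain u where "(v, u) \<in> R ^^ j" "(u, w) \<in> R" using k by auto
    then show ?thesis using Suc k by (auto simp: nball_def)
  qed
next
  fix w assume "w \<in> nball R i v \<union> R `` nball R i v"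
  then show "w \<in> nball R (Suc i) v"
  proof
    assume "w \<in> nball R i v" then show ?thesis by (auto simp: nball_def intro: le_SucI)
  next
    assume "w \<in> R `` nball R i v"
    then obtain u k where "(u, w) \<in> R" "k \<le> i" "(v, u) \<in> R ^^ k" by (auto simp: nball_def)
    then have "(v, w) \<in> R ^^ Suc k" "Suc k \<le> Suc i" by auto
    then show ?thesis unfolding nball_def by blast
  qed
qed

lemma nball_step: "u \<in> nball R i v \<Longrightarrow> (u, w) \<in> R \<Longrightarrow> w \<in> nball R (Suc i) v"
  by (auto simp: nball_Suc)

lemma relpow_subset:
  fixes R Q :: "('a \<times> 'a) set"
  shows "R \<subseteq> Q \<Longrightarrow> (x, y) \<in> R ^^ k \<Longrightarrow> (x, y) \<in> Q ^^ k"
  by (induction k arbitrary: y) auto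

lemma nball_mono: "R \<subseteq> Q \<Longrightarrow> i \<le> j \<Longrightarrow> nball R i v \<subseteq> nball Q j v"
  unfolding nball_def by (auto dest: relpow_subset intro: order_trans)

lemma centre_in_nball [simp]: "v \<in> nball R i v"
  by (auto simp: nball_def intro: exI[of _ 0])

lemma nball_subset: "R \<subseteq> W \<times> W \<Longrightarrow> v \<in> W \<Longrightarrow> nball R i v \<subseteq> W"
  by (induction i) (auto simp: nball_Suc)

lemma colorable_iff_col_on: "colorable (with_proj G) k \<longleftrightarrow> col_on (parcs G) (pverts G) k"
  if "pair_graph G"
proof -
  interpret pair_graph G by fact
  show ?thesis
    unfolding colorable_def col_on_def proper_coloring_def with_proj_simps
    by (intro ex_cong1 conj_cong refl) (use in_arcsD1 in_arcsD2 in fastforce)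
qed

lemma locally_colorable_iff:
  assumes "pair_graph G"
  shows "locally_colorable c r (with_proj G) \<longleftrightarrow>
    (\<forall>v\<in>pverts G. col_on (parcs G) (nball (parcs G) r v) c)"
proof -
  interpret pair_graph G by fact
  show ?thesis
    unfolding locally_colorable_def col_on_def nball_def with_proj_simps
    using colorable_r_ball_iff[OF pair_wf_digraph] by (simp add: Let_def)
qed

section \<open>The upper bound\<close>

lemma slow_growth_step:
  fixes u :: "nat \<Rightarrow> nat" and K :: real
  assumes "u 0 = 1" "real (u (Suc r)) \<le> K ^ Suc r" "K > 0"
  shows "\<exists>i\<le>r. real (u (Suc i)) \<le> K * real (u i)"
proof (rule ccontr)
  assume "\<not> ?thesis"
  then have *: "K * real (u i) < real (u (Suc i))" if "i \<le> r" for i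
    using that by force
  have "K ^ i \<le> real (u i)" if "i \<le> r" for i
    using that
  proof (induction i)
    case (Suc i)
    then have "K * K ^ i \<le> K * real (u i)" using assms(3) by simp
    then show ?case using *[of i] Suc.prems by simp
  qed (use assms in simp)
  from this[of r] have "K ^ Suc r \<le> K * real (u r)" using assms(3) by simp
  then show False using *[of r] assms(2) by simp
qed

text \<open>
  Greedy carving: remove from \<open>W\<close> a ball together with its boundary, keep the ball, and repeat.
  The balls are taken in the graph induced on what is left of \<open>W\<close>.
\<close>

lemma carve_colorable_subset:
  fixes R :: "('a \<times> 'a) set" and K :: real
  assumes "finite W" "sym R" "K \<ge> 1"
    "\<And>v. v \<in> W \<Longrightarrow> col_on R (nball R r v) c" "real (card W) \<le> K ^ Suc r"
  shows "\<exists>S\<subseteq>W. real (card W) \<le> K * real (card S) \<and> col_on R S c"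
  using assms(1,4,5)
proof (induction W rule: finite_psubset_induct)
  case (psubset W)
  show ?case
  proof (cases "W = {}")
    case True
    then show ?thesis by (auto simp: col_on_def)
  next
    case False
    then obtain v where v: "v \<in> W" by blast
    define R' where "R' = R \<inter> W \<times> W"
    define B where "B i = nball R' i v" for i
    have BW: "B i \<subseteq> W" for i
      unfolding B_def R'_def by (rule nball_subset) (use v in auto)
    then have fin: "finite (B i)" for i by (rule finite_subset) (rule psubset.hyps)
    have "card (B (Suc r)) \<le> card W" using BW psubset.hyps by (intro card_mono) auto
    then have "real (card (B (Suc r))) \<le> K ^ Suc r" using psubset.prems(2) by linarith
    then obtain i where i: "i \<le> r" "real (card (B (Suc i))) \<le> K * real (card (B i))"
      using slow_growth_step[of "\<lambda>i. card (B i)" r K] assms(3) by (auto simp: B_def)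
    define W' where "W' = W - B (Suc i)"
    have vB: "v \<in> B (Suc i)" by (simp add: B_def)
    have W': "W' \<subset> W" using v vB by (auto simp: W'_def)
    then have "card W' \<le> card W" using psubset.hyps by (simp add: psubset_card_mono less_imp_le)
    then have "real (card W') \<le> K ^ Suc r" using psubset.prems(2) by linarith
    then obtain S where S: "S \<subseteq> W'" "real (card W') \<le> K * real (card S)" "col_on R S c"
      using psubset.IH[OF W'] psubset.prems(1) W' by (meson psubset_imp_subset subsetD)
    have "B i \<subseteq> B (Suc i)" unfolding B_def by (intro nball_mono) auto
    then have disj: "S \<inter> B i = {}" using S(1) by (auto simp: W'_def)
    have finS: "finite S"
      by (rule finite_subset[OF _ psubset.hyps]) (use S(1) W' in auto)
    have "card W = card W' + card (B (Suc i))"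
      unfolding W'_def
      using card_Diff_subset[OF fin BW] card_mono[OF psubset.hyps BW] by simp
    then have card: "real (card W) \<le> K * real (card (S \<union> B i))"
      using S(2) i(2) disj finS fin by (simp add: card_Un_disjoint algebra_simps)
    have "B i \<subseteq> nball R r v" unfolding B_def R'_def using i by (intro nball_mono) auto
    then have "col_on R (B i) c" by (intro col_on_mono[OF psubset.prems(1)[OF v]]) auto
    then obtain g where g: "g ` B i \<subseteq> {..<c}" "\<forall>x\<in>B i. \<forall>y\<in>B i. (x, y) \<in> R \<longrightarrow> g x \<noteq> g y"
      unfolding col_on_def by blast
    obtain f where f: "f ` S \<subseteq> {..<c}" "\<forall>x\<in>S. \<forall>y\<in>S. (x, y) \<in> R \<longrightarrow> f x \<noteq> f y"
      using S(3) unfolding col_on_def by blast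
    have sep: "(x, y) \<notin> R" if "x \<in> B i" "y \<in> S" for x y
    proof
      assume "(x, y) \<in> R"
      then have "(x, y) \<in> R'" using that BW S(1) W' by (auto simp: R'_def)
      then have "y \<in> B (Suc i)" using that nball_step unfolding B_def by metis
      then show False using that S(1) by (auto simp: W'_def)
    qed
    then have sep': "(y, x) \<notin> R" if "x \<in> B i" "y \<in> S" for x y
      using that assms(2) by (meson symD)
    define h where "h x = (if x \<in> B i then g x else f x)" for x
    have "h ` (S \<union> B i) \<subseteq> {..<c}" using f g by (auto simp: h_def)
    moreover have "\<forall>x\<in>S \<union> B i. \<forall>y\<in>S \<union> B i. (x, y) \<in> R \<longrightarrow> h x \<noteq> h y"
      using f(2) g(2) sep sep' disj unfolding h_def by auto
    ultimately have "col_on R (S \<union> B i) c" unfolding col_on_def by blast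
    moreover have "S \<union> B i \<subseteq> W" using S(1) W' BW by blast
    ultimately show ?thesis using card by blast
  qed
qed

lemma col_on_Un:
  assumes "col_on R S a" "col_on R T b"
  shows "col_on R (S \<union> T) (a + b)"
proof -
  obtain f where f: "f ` S \<subseteq> {..<a}" "\<forall>x\<in>S. \<forall>y\<in>S. (x, y) \<in> R \<longrightarrow> f x \<noteq> f y"
    using assms(1) unfolding col_on_def by blast
  obtain g where g: "g ` T \<subseteq> {..<b}" "\<forall>x\<in>T. \<forall>y\<in>T. (x, y) \<in> R \<longrightarrow> g x \<noteq> g y"
    using assms(2) unfolding col_on_def by blast
  define h where "h x = (if x \<in> S then f x else a + g x)" for x
  have lt: "f x < a" if "x \<in> S" for x using that f by auto
  have "h ` (S \<union> T) \<subseteq> {..<a + b}" using f g by (force simp: h_def)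
  moreover have "h x \<noteq> h y" if "x \<in> S \<union> T" "y \<in> S \<union> T" "(x, y) \<in> R" for x y
    using that f(2) g(2) lt[of x] lt[of y] by (auto simp: h_def)
  ultimately show ?thesis unfolding col_on_def by blast
qed

text \<open>
  With \<open>x = m^(1/(r+1))\<close>, removing at least \<open>m / x = x^r\<close> of \<open>m\<close> vertices decreases the
  \<open>(r+1)\<close>-st root of their number by at least \<open>1/(r+1)\<close>.
\<close>

lemma root_decrease:
  fixes x y :: real
  assumes "x \<ge> 1" "y \<ge> 0" "y ^ Suc r \<le> x ^ Suc r - x ^ r"
  shows "y \<le> x - 1 / real (Suc r)"
proof -
  define t where "t = 1 / (real (Suc r) * x)"
  have rx: "real (Suc r) * x \<ge> 1" using mult_mono[of 1 "real (Suc r)" 1 x] assms(1) by auto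
  have t: "t \<le> 1" "t > 0" using assms(1) rx by (auto simp: t_def)
  have "1 + real (Suc r) * (- t) \<le> (1 + (- t)) ^ Suc r"
    by (rule Bernoulli_inequality) (use t in linarith)
  moreover have "real (Suc r) * t = 1 / x" using assms(1) by (simp add: t_def)
  ultimately have "x ^ Suc r * (1 - 1 / x) \<le> x ^ Suc r * (1 - t) ^ Suc r"
    using assms(1) by (intro mult_left_mono) auto
  moreover have "x ^ Suc r * (1 - 1 / x) = x ^ Suc r - x ^ r"
    using assms(1) by (simp add: algebra_simps)
  ultimately have "y ^ Suc r \<le> (x * (1 - t)) ^ Suc r"
    using assms(3) unfolding power_mult_distrib by linarith
  then have "y \<le> x * (1 - t)"
    by (rule power_le_imp_le_base) (use assms(1) t in auto)
  also have "x * (1 - t) = x - 1 / real (Suc r)"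
    using assms(1) by (simp add: t_def right_diff_distrib)
  finally show ?thesis .
qed

lemma powr_root_power:
  assumes "x \<ge> 0"
  shows "(x powr (1 / (real r + 1))) ^ Suc r = x"
proof (cases "x = 0")
  case False
  have "(x powr (1 / (real r + 1))) ^ Suc r = x powr (1 / (real r + 1) * real (Suc r))"
    using False assms by (subst powr_power) auto
  also have "1 / (real r + 1) * real (Suc r) = 1" by (simp add: field_simps)
  finally show ?thesis using False assms by simp
qed simp

lemma global_coloring_from_local:
  fixes R :: "('a \<times> 'a) set"
  assumes "finite W" "sym R" "\<And>v. v \<in> W \<Longrightarrow> col_on R (nball R r v) c"
  shows "\<exists>k. col_on R W k \<and>
    real k \<le> real c * (real r + 1) * real (card W) powr (1 / (real r + 1))"
  using assms(1,3)
proof (induction W rule: finite_psubset_induct)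
  case (psubset W)
  show ?case
  proof (cases "W = {}")
    case True
    then show ?thesis by (auto simp: col_on_def)
  next
    case False
    define K where "K = real (card W) powr (1 / (real r + 1))"
    have W1: "real (card W) \<ge> 1" using False psubset.hyps
      by (metis One_nat_def Suc_leI card_gt_0_iff of_nat_1 of_nat_mono)
    have K1: "K \<ge> 1" unfolding K_def using W1 by (intro ge_one_powr_ge_zero) auto
    have KW: "K ^ Suc r = real (card W)" unfolding K_def by (rule powr_root_power) simp
    obtain S where S: "S \<subseteq> W" "real (card W) \<le> K * real (card S)" "col_on R S c"
      using carve_colorable_subset[OF psubset.hyps assms(2) K1 psubset.prems] KW by auto
    have "S \<noteq> {}" using S(2) W1 by auto
    define W' where "W' = W - S"
    have W': "W' \<subset> W" using S(1) \<open>S \<noteq> {}\<close> by (auto simp: W'_def)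
    define y where "y = real (card W') powr (1 / (real r + 1))"
    obtain k where k: "col_on R W' k" "real k \<le> real c * (real r + 1) * y"
      using psubset.IH[OF W'] psubset.prems W' unfolding y_def by blast
    have "col_on R (W' \<union> S) (k + c)" using k(1) S(3) by (rule col_on_Un)
    moreover have "W' \<union> S = W" using S(1) by (auto simp: W'_def)
    ultimately have col: "col_on R W (k + c)" by simp
    have "real (card W') = real (card W) - real (card S)"
      unfolding W'_def using S(1) psubset.hyps
      by (metis card_Diff_subset card_mono finite_subset of_nat_diff)
    moreover have "y ^ Suc r = real (card W')" unfolding y_def by (rule powr_root_power) simp
    moreover have "K ^ r \<le> real (card S)"
    proof -
      have "K * K ^ r \<le> K * real (card S)" using S(2) KW by simp
      then show ?thesis using K1 by simp
    qed
    ultimately have "y ^ Suc r \<le> K ^ Suc r - K ^ r" using KW by linarith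
    then have "y \<le> K - 1 / real (Suc r)"
      using K1 by (intro root_decrease) (auto simp: y_def)
    then have "real c * (real r + 1) * y \<le> real c * (real r + 1) * (K - 1 / (real r + 1))"
      by (intro mult_left_mono) (auto simp: add.commute)
    also have "\<dots> = real c * (real r + 1) * K - real c" by (simp add: field_simps)
    finally have "real (k + c) \<le> real c * (real r + 1) * K" using k(2) by simp
    with col show ?thesis unfolding K_def by blast
  qed
qed

lemma max_chromatic_upper:
  assumes "c \<ge> 1"
  shows "real (max_chromatic c r n) \<le> real c * (real r + 1) * real n powr (1 / (real r + 1))"
proof -
  obtain G :: "nat pair_pre_digraph" where G: "pair_graph G" "card (pverts G) = n"
    "locally_colorable c r (with_proj G)"
    "chromatic_number (with_proj G) = max_chromatic c r n"
    using max_chromatic_attained[OF assms] .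
  interpret pair_graph G by fact
  have "sym (parcs G)" using arcs_symmetric by (auto intro: symI)
  then obtain k where k: "col_on (parcs G) (pverts G) k"
    "real k \<le> real c * (real r + 1) * real n powr (1 / (real r + 1))"
    using global_coloring_from_local[OF pair_finite_verts] G(2,3) locally_colorable_iff[OF G(1)]
    by blast
  have "chromatic_number (with_proj G) \<le> k"
    unfolding chromatic_number_def using k(1) colorable_iff_col_on[OF G(1)] by (intro Least_le) simp
  then show ?thesis using k(2) G(4) by linarith
qed

section \<open>Random subsets\<close>

text \<open>
  \<open>wt P p G\<close> is the probability that a random subset of the finite set \<open>P\<close>, containing each element
  independently with probability \<open>p\<close>, equals \<open>G\<close>; \<open>expec\<close> and \<open>prb\<close> are expectation and probability for
  this distribution, as finite sums.
\<close>

definition wt :: "'e set \<Rightarrow> real \<Rightarrow> 'e set \<Rightarrow> real" where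
  "wt P p G = p ^ card G * (1 - p) ^ card (P - G)"

definition expec :: "'e set \<Rightarrow> real \<Rightarrow> ('e set \<Rightarrow> real) \<Rightarrow> real" where
  "expec P p f = (\<Sum>G\<in>Pow P. wt P p G * f G)"

definition prb :: "'e set \<Rightarrow> real \<Rightarrow> ('e set \<Rightarrow> bool) \<Rightarrow> real" where
  "prb P p Q = expec P p (\<lambda>G. of_bool (Q G))"

lemma sum_wt: "finite P \<Longrightarrow> (\<Sum>G\<in>Pow P. wt P p G) = 1"
proof (induction P rule: finite_induct)
  case (insert e P)
  have disj: "Pow P \<inter> insert e ` Pow P = {}" using insert.hyps by auto
  have inj: "inj_on (insert e) (Pow P)" using insert.hyps by (auto simp: inj_on_def)
  have 1: "wt (insert e P) p G = (1 - p) * wt P p G" if "G \<in> Pow P" for G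
  proof -
    have "insert e P - G = insert e (P - G)" using that insert.hyps by auto
    then show ?thesis using insert.hyps by (simp add: wt_def)
  qed
  have 2: "wt (insert e P) p (insert e G) = p * wt P p G" if "G \<in> Pow P" for G
  proof -
    have "insert e P - insert e G = P - G" "finite G" "e \<notin> G"
      using that insert.hyps finite_subset by auto
    then show ?thesis by (simp add: wt_def)
  qed
  have "(\<Sum>G\<in>Pow (insert e P). wt (insert e P) p G) =
      (\<Sum>G\<in>Pow P. wt (insert e P) p G) + (\<Sum>G\<in>insert e ` Pow P. wt (insert e P) p G)"
    unfolding Pow_insert using disj insert.hyps by (intro sum.union_disjoint) auto
  also have "\<dots> = (1 - p) * (\<Sum>G\<in>Pow P. wt P p G) + p * (\<Sum>G\<in>Pow P. wt P p G)"
    using 1 2 by (simp add: sum.reindex[OF inj] sum_distrib_left)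
  finally show ?case using insert.IH by simp
qed (simp add: wt_def)

text \<open>The random subset of \<open>P\<close> with density \<open>p\<close>; the degenerate densities \<open>0\<close> and \<open>1\<close> are excluded.\<close>

locale random_subset =
  fixes P :: "'e set" and p :: real
  assumes finite_P: "finite P" and p_pos: "0 < p" and p_less_1: "p < 1"
begin

abbreviation "E \<equiv> expec P p"
abbreviation "Pr \<equiv> prb P p"

lemma wt_nonneg: "wt P p G \<ge> 0"
  using p_pos p_less_1 by (simp add: wt_def)

lemma E_mono: "(\<And>G. G \<subseteq> P \<Longrightarrow> f G \<le> g G) \<Longrightarrow> E f \<le> E g"
  unfolding expec_def by (intro sum_mono mult_left_mono wt_nonneg) auto

lemma E_cong: "(\<And>G. G \<subseteq> P \<Longrightarrow> f G = g G) \<Longrightarrow> E f = E g"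
  unfolding expec_def by (intro sum.cong) auto

lemma E_add: "E (\<lambda>G. f G + g G) = E f + E g"
  unfolding expec_def by (simp add: distrib_left sum.distrib)

lemma E_cmult: "E (\<lambda>G. a * f G) = a * E f"
  unfolding expec_def by (simp add: sum_distrib_left mult.left_commute)

lemma E_sum: "E (\<lambda>G. \<Sum>i\<in>I. f i G) = (\<Sum>i\<in>I. E (f i))"
  unfolding expec_def by (simp add: sum_distrib_left) (rule sum.swap)

lemma E_const: "E (\<lambda>_. a) = a"
  using sum_wt[OF finite_P] unfolding expec_def by (simp flip: sum_distrib_right)

lemma Pr_mono: "(\<And>G. G \<subseteq> P \<Longrightarrow> Q G \<Longrightarrow> Q' G) \<Longrightarrow> Pr Q \<le> Pr Q'"
  unfolding prb_def by (intro E_mono) auto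

lemma Pr_nonneg: "Pr Q \<ge> 0"
  unfolding prb_def using E_mono[of "\<lambda>_. 0" "\<lambda>G. of_bool (Q G)"] E_const[of 0] by simp

lemma Pr_union:
  assumes "finite I" "\<And>G. G \<subseteq> P \<Longrightarrow> Q G \<Longrightarrow> \<exists>i\<in>I. R i G"
  shows "Pr Q \<le> (\<Sum>i\<in>I. Pr (R i))"
proof -
  have "Pr Q \<le> E (\<lambda>G. \<Sum>i\<in>I. of_bool (R i G))"
    unfolding prb_def
  proof (rule E_mono)
    fix G assume "G \<subseteq> P"
    show "of_bool (Q G) \<le> (\<Sum>i\<in>I. of_bool (R i G) :: real)"
    proof (cases "Q G")
      case True
      then obtain i where i: "i \<in> I" "R i G" using assms(2) \<open>G \<subseteq> P\<close> by blast
      have "of_bool (R i G) \<le> (\<Sum>i\<in>I. of_bool (R i G) :: real)"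
        by (rule member_le_sum) (use i assms in auto)
      then show ?thesis using i True by simp
    qed (simp add: sum_nonneg)
  qed
  then show ?thesis by (simp add: E_sum prb_def)
qed

lemma Markov:
  assumes "\<And>G. f G \<ge> 0" "a > 0"
  shows "Pr (\<lambda>G. f G \<ge> a) \<le> E f / a"
proof -
  have "a * Pr (\<lambda>G. f G \<ge> a) = E (\<lambda>G. a * of_bool (f G \<ge> a))"
    by (simp add: prb_def E_cmult)
  also have "\<dots> \<le> E f" by (intro E_mono) (use assms in auto)
  finally show ?thesis using assms(2) by (simp add: field_simps)
qed

lemma Pr_less_1_obtains:
  assumes "Pr Q < 1"
  obtains G where "G \<subseteq> P" "\<not> Q G"
proof (rule ccontr)
  assume "\<not> thesis"
  then have "E (\<lambda>_. 1) \<le> Pr Q" unfolding prb_def using that by (intro E_mono) auto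
  then show False using assms E_const[of 1] by simp
qed

text \<open>If \<open>Q\<close> has conditional probability at most \<open>y\<close> for every value of \<open>\<tau>\<close>, then \<open>Pr Q \<le> y\<close>.\<close>

lemma Pr_partition:
  assumes "\<And>t. Pr (\<lambda>G. \<tau> G = t \<and> Q G) \<le> y * Pr (\<lambda>G. \<tau> G = t)"
  shows "Pr Q \<le> y"
proof -
  have "Pr Q \<le> (\<Sum>t\<in>\<tau> ` Pow P. Pr (\<lambda>G. \<tau> G = t \<and> Q G))"
    by (rule Pr_union) (use finite_P in auto)
  also have "\<dots> \<le> (\<Sum>t\<in>\<tau> ` Pow P. y * Pr (\<lambda>G. \<tau> G = t))"
    by (intro sum_mono assms)
  also have "\<dots> = y * E (\<lambda>G. \<Sum>t\<in>\<tau> ` Pow P. of_bool (\<tau> G = t))"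
    by (simp add: prb_def E_sum sum_distrib_left)
  also have "E (\<lambda>G. \<Sum>t\<in>\<tau> ` Pow P. of_bool (\<tau> G = t)) = E (\<lambda>_. 1)"
    by (rule E_cong) (use finite_P in \<open>auto simp: of_bool_def\<close>)
  finally show ?thesis by (simp add: E_const)
qed

lemma Pr_eq_sum: "Pr Q = (\<Sum>G\<in>{G \<in> Pow P. Q G}. wt P p G)"
proof -
  have "Pr Q = (\<Sum>G\<in>Pow P. if Q G then wt P p G else 0)"
    unfolding prb_def expec_def by (intro sum.cong) auto
  also have "\<dots> = (\<Sum>G\<in>{G \<in> Pow P. Q G}. wt P p G)"
    using finite_P by (subst sum.inter_filter) auto
  finally show ?thesis .
qed

text \<open>
  The next two lemmas replace conditional independence: given an event that survives the removal of
  certain elements, these are present with probability at most \<open>p\<close> each. Removing \<open>e\<close> multiplies the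
  weight by \<open>(1 - p) / p\<close> and is injective on the sets containing \<open>e\<close>.
\<close>

lemma Pr_remove_one:
  assumes e: "e \<in> P" and closed: "\<And>G. G \<subseteq> P \<Longrightarrow> Q G \<Longrightarrow> Q (G - {e})"
  shows "Pr (\<lambda>G. Q G \<and> e \<in> G) \<le> p * Pr Q"
proof -
  have wt: "(1 - p) * wt P p G = p * wt P p (G - {e})" if "G \<subseteq> P" "e \<in> G" for G
  proof -
    have fin: "finite G" using that finite_P finite_subset by blast
    have "P - (G - {e}) = insert e (P - G)" using that by auto
    then have "card (P - (G - {e})) = Suc (card (P - G))" using that finite_P by simp
    moreover have "card G = Suc (card (G - {e}))" using that fin by (metis card.remove)
    ultimately show ?thesis by (simp add: wt_def)
  qed
  define A where "A = {G \<in> Pow P. Q G \<and> e \<in> G}"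
  have inj: "inj_on (\<lambda>G. G - {e}) A" unfolding A_def inj_on_def by auto
  have "(1 - p) * Pr (\<lambda>G. Q G \<and> e \<in> G) = p * (\<Sum>G\<in>A. wt P p (G - {e}))"
    unfolding Pr_eq_sum sum_distrib_left A_def by (intro sum.cong) (use wt in auto)
  also have "\<dots> = p * (\<Sum>G\<in>(\<lambda>G. G - {e}) ` A. wt P p G)" by (simp add: sum.reindex[OF inj])
  also have "\<dots> \<le> p * Pr (\<lambda>G. Q G \<and> e \<notin> G)"
    unfolding Pr_eq_sum
    by (intro mult_left_mono sum_mono2) (use finite_P p_pos closed wt_nonneg in \<open>auto simp: A_def\<close>)
  finally have "(1 - p) * Pr (\<lambda>G. Q G \<and> e \<in> G) \<le> p * Pr (\<lambda>G. Q G \<and> e \<notin> G)" .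
  moreover have "Pr Q = Pr (\<lambda>G. Q G \<and> e \<in> G) + Pr (\<lambda>G. Q G \<and> e \<notin> G)"
    unfolding prb_def E_add[symmetric] by (rule E_cong) auto
  ultimately show ?thesis by (simp add: algebra_simps)
qed

lemma Pr_remove:
  assumes "X \<subseteq> P" and "\<And>G e. G \<subseteq> P \<Longrightarrow> Q G \<Longrightarrow> e \<in> X \<Longrightarrow> Q (G - {e})"
  shows "Pr (\<lambda>G. Q G \<and> X \<subseteq> G) \<le> p ^ card X * Pr Q"
proof -
  have "finite X" using assms(1) finite_P finite_subset by blast
  then show ?thesis using assms
  proof (induction X rule: finite_induct)
    case (insert e X)
    have "Pr (\<lambda>G. Q G \<and> insert e X \<subseteq> G) = Pr (\<lambda>G. (Q G \<and> X \<subseteq> G) \<and> e \<in> G)"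
      by (rule arg_cong[where f = Pr]) auto
    also have "\<dots> \<le> p * Pr (\<lambda>G. Q G \<and> X \<subseteq> G)"
      by (rule Pr_remove_one) (use insert in auto)
    also have "\<dots> \<le> p * (p ^ card X * Pr Q)"
      using insert p_pos by (intro mult_left_mono insert.IH) auto
    finally show ?case using insert.hyps by simp
  qed simp
qed

lemma Pr_avoid:
  assumes "Y \<subseteq> P"
  shows "Pr (\<lambda>G. G \<inter> Y = {}) \<le> (1 - p) ^ card Y"
proof -
  have "Pr (\<lambda>G. G \<inter> Y = {}) = (\<Sum>G\<in>{G \<in> Pow P. G \<inter> Y = {}}. wt P p G)"
    by (rule Pr_eq_sum)
  also have "{G \<in> Pow P. G \<inter> Y = {}} = Pow (P - Y)" by auto
  also have "(\<Sum>G\<in>Pow (P - Y). wt P p G) = (\<Sum>G\<in>Pow (P - Y). (1 - p) ^ card Y * wt (P - Y) p G)"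
  proof (rule sum.cong)
    fix G assume G: "G \<in> Pow (P - Y)"
    have "P - G = (P - Y - G) \<union> Y" using G assms by auto
    moreover have "card ((P - Y - G) \<union> Y) = card (P - Y - G) + card Y"
      using finite_P assms finite_subset by (intro card_Un_disjoint) auto
    ultimately show "wt P p G = (1 - p) ^ card Y * wt (P - Y) p G"
      by (simp add: wt_def power_add)
  qed simp
  also have "\<dots> = (1 - p) ^ card Y"
    using sum_wt[of "P - Y" p] finite_P by (simp flip: sum_distrib_left)
  finally show ?thesis by simp
qed

end

section \<open>Breadth-first search trees\<close>

text \<open>A graph is encoded as a set of two-element sets; this is its adjacency relation.\<close>

definition adj :: "'a set set \<Rightarrow> ('a \<times> 'a) set" where
  "adj G = {(x, y). {x, y} \<in> G}"

text \<open>The distance of \<open>y\<close> from \<open>v\<close>; it is meaningful only for \<open>y\<close> reachable from \<open>v\<close>.\<close>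

definition level :: "nat set set \<Rightarrow> nat \<Rightarrow> nat \<Rightarrow> nat" where
  "level G v y = (LEAST i. y \<in> nball (adj G) i v)"

text \<open>
  The least neighbor of \<open>y\<close> on the previous level, for \<open>y \<noteq> v\<close> reachable from \<open>v\<close>. Choosing the
  least one makes the tree of parents invariant under the deletion of other edges.
\<close>

definition parent :: "nat set set \<Rightarrow> nat \<Rightarrow> nat \<Rightarrow> nat" where
  "parent G v y = (LEAST x. {x, y} \<in> G \<and> x \<in> nball (adj G) (level G v y - 1) v)"

text \<open>
  The breadth-first search tree of depth \<open>r\<close> rooted at \<open>v\<close>: its vertex set and its parent function. The
  root, as well as every vertex outside the ball, is mapped to \<open>v\<close>, so that the parent
  function can be iterated freely.
\<close>

definition bfs :: "nat \<Rightarrow> nat \<Rightarrow> nat set set \<Rightarrow> nat set \<times> (nat \<Rightarrow> nat)" where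
  "bfs r v G = (nball (adj G) r v,
     \<lambda>y. if y \<in> nball (adj G) r v \<and> y \<noteq> v then parent G v y else v)"

lemma sym_adj: "sym (adj G)"
  by (auto simp: adj_def insert_commute intro: symI)

lemma level_le: "y \<in> nball (adj G) i v \<Longrightarrow> level G v y \<le> i"
  unfolding level_def by (rule Least_le)

lemma in_nball_level: "y \<in> nball (adj G) i v \<Longrightarrow> y \<in> nball (adj G) (level G v y) v"
  unfolding level_def by (rule LeastI)

lemma level_pos:
  assumes "y \<in> nball (adj G) i v" "y \<noteq> v"
  shows "level G v y > 0"
  using in_nball_level[OF assms(1)] assms(2) by (cases "level G v y") auto

lemma parent:
  assumes "y \<in> nball (adj G) i v" "y \<noteq> v"
  shows "{parent G v y, y} \<in> G" "parent G v y \<in> nball (adj G) (level G v y - 1) v"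
proof -
  obtain l where l: "level G v y = Suc l"
    using level_pos[OF assms] gr0_conv_Suc by blast
  have "y \<in> nball (adj G) (Suc l) v" using in_nball_level[OF assms(1)] l by simp
  moreover have "y \<notin> nball (adj G) l v" using level_le[of y G l v] l by auto
  ultimately obtain x where "x \<in> nball (adj G) l v" "{x, y} \<in> G"
    by (auto simp: nball_Suc adj_def)
  then have "\<exists>x. {x, y} \<in> G \<and> x \<in> nball (adj G) (level G v y - 1) v" using l by auto
  then have "{parent G v y, y} \<in> G \<and> parent G v y \<in> nball (adj G) (level G v y - 1) v"
    unfolding parent_def by (rule LeastI_ex)
  then show "{parent G v y, y} \<in> G" "parent G v y \<in> nball (adj G) (level G v y - 1) v" by auto
qed

lemma bfs_remove:
  assumes t: "bfs r v G = (B, \<pi>)" and e: "\<And>y. y \<in> B \<Longrightarrow> e \<noteq> {y, \<pi> y}"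
  shows "bfs r v (G - {e}) = (B, \<pi>)"
proof -
  let ?G = "G - {e}"
  have B: "B = nball (adj G) r v" using t by (simp add: bfs_def)
  have \<pi>: "\<pi> y = parent G v y" if "y \<in> B" "y \<noteq> v" for y
    using t that by (auto simp: bfs_def)
  have sub: "adj ?G \<subseteq> adj G" by (auto simp: adj_def)
  have edge: "{parent G v y, y} \<in> ?G" if "y \<in> B" "y \<noteq> v" for y
    using e[OF that(1)] \<pi>[OF that] parent(1)[of y G r v] that B by (auto simp: insert_commute)
  have ball: "nball (adj ?G) i v = nball (adj G) i v" if "i \<le> r" for i
    using that
  proof (induction i)
    case (Suc i)
    have IH: "nball (adj ?G) i v = nball (adj G) i v" using Suc by simp
    have "y \<in> nball (adj ?G) (Suc i) v" if y: "y \<in> nball (adj G) (Suc i) v" for y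
    proof (cases "y = v")
      case False
      have "y \<in> B" using y nball_mono[OF order_refl Suc.prems, of "adj G" v] B by blast
      have "parent G v y \<in> nball (adj G) (level G v y - 1) v" using parent(2)[OF y False] .
      moreover have "level G v y - 1 \<le> i" using level_le[OF y] by simp
      ultimately have "parent G v y \<in> nball (adj ?G) i v"
        unfolding IH using nball_mono[OF order_refl, of "level G v y - 1" i "adj G" v] by blast
      then show ?thesis
        using edge[OF \<open>y \<in> B\<close> False] by (intro nball_step) (auto simp: adj_def)
    qed simp
    then show ?case using nball_mono[OF sub order_refl, of "Suc i" v] by blast
  qed simp
  have lev: "level ?G v y = level G v y" if "y \<in> B" for y
  proof (rule antisym)
    have y: "y \<in> nball (adj G) r v" "y \<in> nball (adj ?G) r v" using that ball[of r] B by auto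
    show "level ?G v y \<le> level G v y"
      using level_le[OF y(1)] in_nball_level[OF y(1)] by (intro level_le) (simp add: ball)
    show "level G v y \<le> level ?G v y"
      using level_le[OF y(2)] in_nball_level[OF y(2)] by (intro level_le) (simp add: ball)
  qed
  have par: "parent ?G v y = parent G v y" if y: "y \<in> B" "y \<noteq> v" for y
  proof -
    have l: "nball (adj ?G) (level G v y - 1) v = nball (adj G) (level G v y - 1) v"
      using level_le[of y G r v] y B by (intro ball) auto
    have 1: "{parent G v y, y} \<in> ?G \<and> parent G v y \<in> nball (adj G) (level G v y - 1) v"
      using edge[OF y] parent(2)[of y G r v] y B by blast
    show ?thesis
      unfolding parent_def[of ?G] lev[OF y(1)] l
    proof (rule Least_equality)
      fix x assume "{x, y} \<in> ?G \<and> x \<in> nball (adj G) (level G v y - 1) v"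
      then show "parent G v y \<le> x" unfolding parent_def by (intro Least_le) auto
    qed (rule 1)
  qed
  have "bfs r v ?G = bfs r v G"
    unfolding bfs_def ball[OF order_refl] B[symmetric] using par by auto
  then show ?thesis using t by simp
qed

lemma three_colorable_if_2_degenerate:
  assumes "finite B" "sym R" "irrefl R"
    "\<And>H. H \<subseteq> B \<Longrightarrow> H \<noteq> {} \<Longrightarrow> \<exists>h\<in>H. card {x \<in> H. (h, x) \<in> R} \<le> 2"
  shows "col_on R B 3"
  using assms(1,4)
proof (induction B rule: finite_psubset_induct)
  case (psubset B)
  show ?case
  proof (cases "B = {}")
    case True
    then show ?thesis by (auto simp: col_on_def)
  next
    case False
    then obtain h where h: "h \<in> B" "card {x \<in> B. (h, x) \<in> R} \<le> 2"
      using psubset.prems[OF order_refl] by blast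
    have "col_on R (B - {h}) 3"
    proof (rule psubset.IH)
      show "B - {h} \<subset> B" using h by auto
      show "\<exists>h\<in>H. card {x \<in> H. (h, x) \<in> R} \<le> 2" if "H \<subseteq> B - {h}" "H \<noteq> {}" for H
        by (rule psubset.prems) (use that in auto)
    qed
    then obtain f :: "_ \<Rightarrow> nat" where f: "f ` (B - {h}) \<subseteq> {..<3}"
      "\<forall>x\<in>B - {h}. \<forall>y\<in>B - {h}. (x, y) \<in> R \<longrightarrow> f x \<noteq> f y"
      by (rule col_onE)
    define N where "N = {x \<in> B. (h, x) \<in> R}"
    have "finite N" unfolding N_def using psubset.hyps by auto
    then have "card (f ` N) \<le> 2" using h(2) card_image_le[of N f] N_def by simp
    then have "\<not> {..<3} \<subseteq> f ` N"
      using card_mono[of "f ` N" "{..<3}"] \<open>finite N\<close> by auto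
    then obtain k where k: "k < 3" "k \<notin> f ` N" by auto
    have hh: "(h, h) \<notin> R" using assms(3) by (auto simp: irrefl_def)
    define g where "g = f(h := k)"
    have "g ` B \<subseteq> {..<3}" using f(1) k by (auto simp: g_def)
    moreover have "g x \<noteq> g y" if "x \<in> B" "y \<in> B" "(x, y) \<in> R" for x y
    proof (cases "x = h \<or> y = h")
      case True
      define z where "z = (if x = h then y else x)"
      have "z \<in> B" "(h, z) \<in> R" "z \<noteq> h"
        using that True hh assms(2) by (auto simp: z_def dest: symD)
      then have "f z \<noteq> k" using k by (auto simp: N_def)
      then show ?thesis using True that hh by (auto simp: g_def z_def split: if_splits)
    next
      case False
      then show ?thesis using f(2) that by (auto simp: g_def)
    qed
    ultimately show ?thesis unfolding col_on_def by blast
  qed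
qed

text \<open>The elements of \<open>A\<close> and their ancestors up to \<open>r\<close> generations, for the parent function \<open>\<pi>\<close>.\<close>

definition ancestors :: "('a \<Rightarrow> 'a) \<Rightarrow> nat \<Rightarrow> 'a set \<Rightarrow> 'a set" where
  "ancestors \<pi> r A = {(\<pi> ^^ k) a |k a. k \<le> r \<and> a \<in> A}"

text \<open>
  The possible edges between \<open>A\<close> and the ancestors of \<open>A\<close>; the degenerate \<open>{a, a} = {a}\<close>, which is not
  an edge, is included for simplicity.
\<close>

definition spokes :: "('a \<Rightarrow> 'a) \<Rightarrow> nat \<Rightarrow> 'a set \<Rightarrow> 'a set set" where
  "spokes \<pi> r A = {{a, s} |a s. a \<in> A \<and> s \<in> ancestors \<pi> r A}"

lemma ancestors_image: "ancestors \<pi> r A = (\<lambda>(k, a). (\<pi> ^^ k) a) ` ({..r} \<times> A)"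
  unfolding ancestors_def by auto

lemma finite_ancestors: "finite A \<Longrightarrow> finite (ancestors \<pi> r A)"
  unfolding ancestors_image by blast

lemma card_ancestors:
  assumes "finite A"
  shows "card (ancestors \<pi> r A) \<le> (r + 1) * card A"
  unfolding ancestors_image
  by (rule order_trans[OF card_image_le]) (use assms in \<open>auto simp: card_cartesian_product\<close>)

lemma spokes_image: "spokes \<pi> r A = (\<lambda>(a, s). {a, s}) ` (A \<times> ancestors \<pi> r A)"
  unfolding spokes_def by auto

lemma finite_spokes: "finite A \<Longrightarrow> finite (spokes \<pi> r A)"
  unfolding spokes_image by (simp add: finite_ancestors)

lemma card_spokes:
  assumes "finite A"
  shows "card (spokes \<pi> r A) \<le> (r + 1) * (card A)\<^sup>2"
proof -
  have "card (spokes \<pi> r A) \<le> card A * card (ancestors \<pi> r A)"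
    unfolding spokes_image
    by (rule order_trans[OF card_image_le]) (use assms finite_ancestors in \<open>auto simp: card_cartesian_product\<close>)
  also have "\<dots> \<le> card A * ((r + 1) * card A)"
    using card_ancestors[OF assms] by (rule mult_left_mono) simp
  finally show ?thesis by (simp add: power2_eq_square algebra_simps)
qed

text \<open>Each step to the parent decreases the level, except at the root.\<close>

lemma bfs_descend:
  assumes t: "bfs r v G = (B, \<pi>)" and z: "z \<in> B"
  shows "(\<pi> ^^ k) z \<in> B"
    and "level G v ((\<pi> ^^ k) z) \<le> level G v z - k"
    and "(\<pi> ^^ k) z = z \<or> level G v ((\<pi> ^^ k) z) < level G v z"
proof -
  have B: "B = nball (adj G) r v" using t by (simp add: bfs_def)
  have lv: "level G v v = 0" using level_le[of v G 0 v] by simp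
  have step: "\<pi> y \<in> B \<and> level G v (\<pi> y) \<le> level G v y - 1 \<and>
      (\<pi> y = y \<or> level G v (\<pi> y) < level G v y)" if y: "y \<in> B" for y
  proof (cases "y = v")
    case True
    then have "\<pi> y = v" using t by (auto simp: bfs_def)
    then show ?thesis using True y lv by simp
  next
    case False
    have yb: "y \<in> nball (adj G) r v" using y B by simp
    have p: "\<pi> y = parent G v y" using t y False by (auto simp: bfs_def)
    have le: "level G v (\<pi> y) \<le> level G v y - 1"
      unfolding p by (rule level_le) (rule parent(2)[OF yb False])
    have "\<pi> y \<in> B"
      using parent(2)[OF yb False] level_le[OF yb] nball_mono[OF order_refl, of "level G v y - 1" r "adj G" v]
      unfolding p B by (meson diff_le_self order_trans subsetD)
    then show ?thesis using le level_pos[OF yb False] by linarith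
  qed
  have "(\<pi> ^^ k) z \<in> B \<and> level G v ((\<pi> ^^ k) z) \<le> level G v z - k \<and>
      ((\<pi> ^^ k) z = z \<or> level G v ((\<pi> ^^ k) z) < level G v z)"
  proof (induction k)
    case (Suc k)
    show ?case using step[of "(\<pi> ^^ k) z"] Suc by auto
  qed (use z in simp)
  then show "(\<pi> ^^ k) z \<in> B" "level G v ((\<pi> ^^ k) z) \<le> level G v z - k"
    "(\<pi> ^^ k) z = z \<or> level G v ((\<pi> ^^ k) z) < level G v z" by auto
qed

lemma double_count_edges:
  assumes "finite A" "finite X" "\<And>e. e \<in> X \<Longrightarrow> card {a \<in> A. a \<in> e} \<le> 2"
    "\<And>a. a \<in> A \<Longrightarrow> card {e \<in> X. a \<in> e} \<ge> 2"
  shows "card A \<le> card X"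
proof -
  have "2 * card A = (\<Sum>a\<in>A. 2)" by simp
  also have "\<dots> \<le> (\<Sum>a\<in>A. card {e \<in> X. a \<in> e})" by (intro sum_mono assms)
  also have "\<dots> = (\<Sum>a\<in>A. \<Sum>e\<in>X. if a \<in> e then 1 else 0)"
    using assms(2) by (simp add: sum.inter_filter[symmetric])
  also have "\<dots> = (\<Sum>e\<in>X. \<Sum>a\<in>A. if a \<in> e then 1 else 0)" by (rule sum.swap)
  also have "\<dots> = (\<Sum>e\<in>X. card {a \<in> A. a \<in> e})"
    using assms(1) by (simp add: sum.inter_filter[symmetric])
  also have "\<dots> \<le> (\<Sum>e\<in>X. 2)" by (intro sum_mono assms)
  finally show ?thesis by simp
qed

text \<open>
  The combinatorial core of the lower bound. In the tree, \<open>A\<close> consists of the lowest vertices of a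
  set \<open>H\<close> with minimum degree three: each of them is joined to \<open>H\<close> by at least two non-tree edges, and
  an edge is counted for at most two vertices of \<open>A\<close>.
\<close>

lemma non_three_colorable_witness:
  assumes t: "bfs r v G = (B, \<pi>)" and fin: "finite B" and irr: "irrefl (adj G)"
    and ncol: "\<not> col_on (adj G) B 3"
  obtains A X where "A \<subseteq> B" "A \<noteq> {}" "X \<subseteq> spokes \<pi> r A" "card X = card A" "X \<subseteq> G"
    "\<And>y. y \<in> B \<Longrightarrow> {y, \<pi> y} \<notin> X"
proof -
  have B: "B = nball (adj G) r v" using t by (simp add: bfs_def)
  have loop: "{x} \<notin> G" for x using irr by (auto simp: irrefl_def adj_def)
  obtain H where H: "H \<subseteq> B" "H \<noteq> {}" "\<And>h. h \<in> H \<Longrightarrow> card {x \<in> H. {h, x} \<in> G} > 2"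
  proof -
    have "\<exists>H\<subseteq>B. H \<noteq> {} \<and> (\<forall>h\<in>H. \<not> card {x \<in> H. (h, x) \<in> adj G} \<le> 2)"
      using three_colorable_if_2_degenerate[OF fin sym_adj irr] ncol by meson
    then show thesis using that unfolding adj_def not_le mem_Collect_eq prod.case by meson
  qed
  have finH: "finite H" using H(1) fin finite_subset by blast
  define A where "A = {a \<in> H. \<forall>u\<in>H. \<forall>k. (\<pi> ^^ k) u = a \<longrightarrow> u = a}"
  have AH: "A \<subseteq> H" by (auto simp: A_def)
  then have finA: "finite A" using finH finite_subset by blast
  have lev0: "z = v" if "z \<in> B" "level G v z = 0" for z
    using level_pos[of z G r v] that B by auto
  have HS: "h \<in> ancestors \<pi> r A" if h: "h \<in> H" for h
  proof -
    define D where "D = {u \<in> H. \<exists>k. (\<pi> ^^ k) u = h}"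
    have "h \<in> D" using h by (auto simp: D_def intro: exI[of _ 0])
    moreover have "finite D" using finH by (auto simp: D_def)
    ultimately have "Max (level G v ` D) \<in> level G v ` D" by (intro Max_in) auto
    then obtain u where u: "u \<in> D" "level G v u = Max (level G v ` D)" by auto
    have umax: "level G v w \<le> level G v u" if "w \<in> D" for w
      unfolding u(2) using that \<open>finite D\<close> by (intro Max_ge) auto
    \<comment> \<open>a deepest descendant of \<open>h\<close> in \<open>H\<close> has no further descendants in \<open>H\<close>\<close>
    have uB: "u \<in> B" using u(1) H(1) by (auto simp: D_def)
    obtain k where k: "(\<pi> ^^ k) u = h" using u(1) by (auto simp: D_def)
    have "u \<in> A"
      unfolding A_def
    proof (intro CollectI conjI ballI allI impI)
      fix w j assume w: "w \<in> H" "(\<pi> ^^ j) w = u"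
      then have "(\<pi> ^^ (k + j)) w = h" using k by (simp add: funpow_add)
      then have "level G v w \<le> level G v u" using w by (intro umax) (auto simp: D_def)
      then show "w = u" using bfs_descend(3)[OF t, of w j] w H(1) by auto
    qed (use u(1) in \<open>auto simp: D_def\<close>)
    moreover have "\<exists>k'\<le>r. (\<pi> ^^ k') u = h"
    proof (cases "k \<le> r")
      case False
      \<comment> \<open>after \<open>r\<close> steps the root is reached, where \<open>\<pi>\<close> stays\<close>
      have "level G v u \<le> r" using level_le[of u G r v] uB B by simp
      then have "level G v ((\<pi> ^^ k) u) = 0" "level G v ((\<pi> ^^ r) u) = 0"
        using bfs_descend(2)[OF t uB, of k] bfs_descend(2)[OF t uB, of r] False by linarith+
      then have "(\<pi> ^^ k) u = v" "(\<pi> ^^ r) u = v" using lev0 bfs_descend(1)[OF t uB] by auto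
      then show ?thesis using k by auto
    qed (use k in auto)
    ultimately show ?thesis unfolding ancestors_def by blast
  qed
  have "A \<noteq> {}" using HS H(2) unfolding ancestors_def by blast
  define N where "N a = {x \<in> H. {a, x} \<in> G \<and> x \<noteq> \<pi> a}" for a
  have finN: "finite (N a)" for a using finH by (simp add: N_def)
  have cardN: "card (N a) \<ge> 2" if "a \<in> A" for a
  proof -
    have "card {x \<in> H. {a, x} \<in> G} \<le> card (insert (\<pi> a) (N a))"
      using finN by (intro card_mono) (auto simp: N_def)
    also have "\<dots> \<le> Suc (card (N a))" by (rule card_insert_le_m1) auto
    finally show ?thesis using H(3)[of a] that AH by fastforce
  qed
  define X0 where "X0 = {{a, x} |a x. a \<in> A \<and> x \<in> N a}"
  have X0: "X0 \<subseteq> spokes \<pi> r A" using HS by (auto simp: X0_def N_def spokes_def)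
  then have finX: "finite X0" using finite_spokes[OF finA] finite_subset by blast
  have "card A \<le> card X0"
  proof (rule double_count_edges[OF finA finX])
    fix e assume "e \<in> X0"
    then obtain a x where "e = {a, x}" by (auto simp: X0_def)
    then have "card {a \<in> A. a \<in> e} \<le> card {a, x}" by (intro card_mono) auto
    also have "\<dots> \<le> 2" by (simp add: card_insert_if)
    finally show "card {a \<in> A. a \<in> e} \<le> 2" .
  next
    fix a assume a: "a \<in> A"
    have "2 \<le> card (N a)" using cardN a .
    also have "\<dots> = card ((\<lambda>x. {a, x}) ` N a)"
      by (intro card_image[symmetric]) (auto simp: inj_on_def doubleton_eq_iff)
    also have "\<dots> \<le> card {e \<in> X0. a \<in> e}"
      using finX a by (intro card_mono) (auto simp: X0_def)
    finally show "card {e \<in> X0. a \<in> e} \<ge> 2" .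
  qed
  then obtain X where X: "X \<subseteq> X0" "card X = card A"
    using obtain_subset_with_card_n by metis
  have tree: "{y, \<pi> y} \<notin> X0" if "y \<in> B" for y
  proof
    assume "{y, \<pi> y} \<in> X0"
    then obtain a x where ax: "{y, \<pi> y} = {a, x}" "a \<in> A" "x \<in> H" "{a, x} \<in> G" "x \<noteq> \<pi> a"
      by (auto simp: X0_def N_def)
    then have "a = \<pi> x" by (auto simp: doubleton_eq_iff)
    then have "(\<pi> ^^ 1) x = a" by simp
    then have "x = a" using ax(2,3) unfolding A_def by blast
    then show False using ax(4) loop by simp
  qed
  show thesis
    by (rule that[of A X]) (use AH H(1) \<open>A \<noteq> {}\<close> X X0 tree in \<open>auto simp: X0_def N_def\<close>)
qed

section \<open>Balls and independent sets in the random graph\<close>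

text \<open>The edges of the complete graph on \<open>V\<close>.\<close>

definition edges :: "nat set \<Rightarrow> nat set set" where
  "edges V = {e. e \<subseteq> V \<and> card e = 2}"

lemma finite_edges: "finite V \<Longrightarrow> finite (edges V)"
  by (auto simp: edges_def)

lemma card_edges: "finite V \<Longrightarrow> card (edges V) = card V choose 2"
  unfolding edges_def by (rule n_subsets)

lemma doubleton_in_edges: "{x, y} \<in> edges V \<longleftrightarrow> x \<in> V \<and> y \<in> V \<and> x \<noteq> y"
  by (auto simp: edges_def card_insert_if)

lemma irrefl_adj: "G \<subseteq> edges V \<Longrightarrow> irrefl (adj G)"
  using doubleton_in_edges[of _ _ V] unfolding irrefl_def adj_def by blast

lemma nball_subset_vertices:
  assumes "G \<subseteq> edges V" "v \<in> V"
  shows "nball (adj G) i v \<subseteq> V"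
proof (rule nball_subset)
  show "adj G \<subseteq> V \<times> V" using assms(1) doubleton_in_edges[of _ _ V] unfolding adj_def by blast
qed (rule assms)

text \<open>An edge that leaves a ball plays no role for the ball itself.\<close>

lemma nball_remove_exit:
  assumes y: "y \<notin> nball (adj G) i v" and "j \<le> i"
  shows "nball (adj (G - {{x, y}})) j v = nball (adj G) j v"
  using assms(2)
proof (induction j)
  case (Suc j)
  let ?G = "G - {{x, y}}"
  have IH: "nball (adj ?G) j v = nball (adj G) j v" using Suc by simp
  have sub: "nball (adj G) k v \<subseteq> nball (adj G) i v" if "k \<le> i" for k
    using that by (intro nball_mono) auto
  have "w \<in> nball (adj ?G) (Suc j) v" if w: "w \<in> nball (adj G) (Suc j) v" for w
  proof (cases "w \<in> nball (adj G) j v")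
    case True
    then show ?thesis using IH by (simp add: nball_Suc)
  next
    case False
    then obtain u where u: "u \<in> nball (adj G) j v" "{u, w} \<in> G"
      using w by (auto simp: nball_Suc adj_def)
    have "u \<noteq> y" "w \<noteq> y" using u(1) w y sub[of j] sub[of "Suc j"] Suc.prems by auto
    then have "(u, w) \<in> adj ?G" using u(2) by (auto simp: adj_def doubleton_eq_iff)
    then show ?thesis using u(1) IH by (intro nball_step) auto
  qed
  moreover have "nball (adj ?G) (Suc j) v \<subseteq> nball (adj G) (Suc j) v"
    by (intro nball_mono) (auto simp: adj_def)
  ultimately show ?case by blast
qed simp

text \<open>A weak form of Stirling's lower bound for the factorial, from \<open>e \<le> 3\<close>.\<close>

lemma power_self_le_fact: "real l ^ l \<le> 3 ^ l * fact l"
proof (induction l)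
  case (Suc l)
  have "real (Suc l) ^ l \<le> 3 * real l ^ l"
  proof (cases "l = 0")
    case False
    have "(1 + 1 / real l) ^ l \<le> exp 1"
      by (rule exp_ge_one_plus_x_over_n_power_n) (use False in auto)
    also have "\<dots> \<le> 3" by (rule exp_le)
    finally have "real l ^ l * (1 + 1 / real l) ^ l \<le> real l ^ l * 3"
      by (intro mult_left_mono) auto
    moreover have "real l * (1 + 1 / real l) = real (Suc l)" using False by (simp add: field_simps)
    ultimately show ?thesis by (simp flip: power_mult_distrib)
  qed simp
  then have "real (Suc l) * real (Suc l) ^ l \<le> real (Suc l) * (3 * (3 ^ l * fact l))"
    using Suc by (intro mult_left_mono) auto
  then show ?case by (simp add: algebra_simps)
qed simp

text \<open>
  The union bound over all witnesses of size \<open>l\<close>: there are \<open>b choose l\<close> sets \<open>A\<close> in a ball with \<open>b\<close>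
  vertices, and \<open>l\<close> edges are chosen from at most \<open>(r + 1) l^2\<close> spokes.
\<close>

lemma witness_count_bound:
  assumes "p \<ge> 0"
  shows "real (b choose l) * real (((r + 1) * l\<^sup>2) choose l) * p ^ l
    \<le> (9 * (real r + 1) * real b * p) ^ l"
proof -
  have bf: "real (m choose l) * fact l \<le> real m ^ l" for m
  proof -
    have "real ((m choose l) * fact l) \<le> real (m ^ l)"
      unfolding of_nat_le_iff by (rule binomial_fact_pow)
    then show ?thesis by simp
  qed
  have "real (b choose l) * real (((r + 1) * l\<^sup>2) choose l) * (fact l)\<^sup>2 =
      (real (b choose l) * fact l) * (real (((r + 1) * l\<^sup>2) choose l) * fact l)"
    by (simp add: power2_eq_square)
  also have "\<dots> \<le> real b ^ l * real ((r + 1) * l\<^sup>2) ^ l"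
    by (intro mult_mono bf) auto
  also have "real ((r + 1) * l\<^sup>2) = (real r + 1) * (real l * real l)"
    by (simp add: power2_eq_square algebra_simps)
  also have "real b ^ l * ((real r + 1) * (real l * real l)) ^ l =
      real b ^ l * (real r + 1) ^ l * (real l ^ l)\<^sup>2"
    unfolding power_mult_distrib power2_eq_square by (simp only: mult.assoc)
  also have "\<dots> \<le> real b ^ l * (real r + 1) ^ l * (3 ^ l * fact l)\<^sup>2"
    by (intro mult_left_mono power_mono power_self_le_fact) auto
  also have "\<dots> = (9 * (real r + 1) * real b) ^ l * (fact l)\<^sup>2"
  proof -
    have "(9::real) ^ l = 3 ^ l * 3 ^ l" by (simp flip: power_mult_distrib)
    then show ?thesis by (simp only: power_mult_distrib power2_eq_square mult_ac)
  qed
  finally have "real (b choose l) * real (((r + 1) * l\<^sup>2) choose l) \<le> (9 * (real r + 1) * real b) ^ l"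
    by simp
  then have "real (b choose l) * real (((r + 1) * l\<^sup>2) choose l) * p ^ l \<le>
      (9 * (real r + 1) * real b) ^ l * p ^ l"
    using assms by (intro mult_right_mono) auto
  then show ?thesis by (simp add: power_mult_distrib)
qed

lemma geometric_ninth:
  fixes z :: real
  assumes "0 \<le> z" "z \<le> 1 / 9"
  shows "(\<Sum>l=1..m. z ^ l) \<le> 1 / 8"
proof -
  have "(\<Sum>l=1..m. z ^ l) \<le> (\<Sum>l=1..m. (1 / 9) ^ l)"
    using assms by (intro sum_mono power_mono) auto
  also have "\<dots> = (1 - (1 / 9) ^ m) / 8" by (induction m) (simp_all add: diff_divide_distrib)
  also have "\<dots> \<le> 1 / 8" by simp
  finally show ?thesis .
qed

text \<open>The binomial random graph \<open>G(n, p)\<close> on the vertex set \<open>V\<close>.\<close>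

locale random_graph =
  fixes V :: "nat set" and p :: real
  assumes finite_V: "finite V" and p_bounds: "0 < p" "p < 1"

sublocale random_graph \<subseteq> random_subset "edges V" p
  using finite_V p_bounds finite_edges by unfold_locales auto

context random_graph
begin

abbreviation "n \<equiv> real (card V)"

lemma Pr_False: "Pr (\<lambda>_. False) = 0"
  using E_const[of 0] by (simp add: prb_def)

lemma Pr_impossible: "(\<And>G. G \<subseteq> edges V \<Longrightarrow> \<not> Q G) \<Longrightarrow> Pr Q = 0"
  using Pr_mono[of Q "\<lambda>_. False"] Pr_False Pr_nonneg[of Q] by fastforce

lemma Pr_not_three_colorable_given_bfs:
  assumes B: "finite B"
  shows "Pr (\<lambda>G. bfs r v G = (B, \<pi>) \<and> \<not> col_on (adj G) B 3) \<le>
    (\<Sum>l=1..card B. (9 * (real r + 1) * real (card B) * p) ^ l) * Pr (\<lambda>G. bfs r v G = (B, \<pi>))"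
proof -
  define \<A> where "\<A> l = {A. A \<subseteq> B \<and> card A = l}" for l
  define \<X> where "\<X> A = {X. X \<subseteq> spokes \<pi> r A \<and> card X = card A}" for A
  define Q where "Q X G \<longleftrightarrow> bfs r v G = (B, \<pi>) \<and> (\<forall>y\<in>B. {y, \<pi> y} \<notin> X) \<and> X \<subseteq> G" for X G
  have fA: "finite A" if "A \<in> \<A> l" for A l using that B finite_subset by (auto simp: \<A>_def)
  have fX: "finite (\<X> A)" if "A \<in> \<A> l" for A l
    using finite_spokes[OF fA[OF that]] by (simp add: \<X>_def)
  have PrQ: "Pr (Q X) \<le> p ^ card X * Pr (\<lambda>G. bfs r v G = (B, \<pi>))" for X
  proof (cases "X \<subseteq> edges V \<and> (\<forall>y\<in>B. {y, \<pi> y} \<notin> X)")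
    case True
    have "Pr (Q X) = Pr (\<lambda>G. bfs r v G = (B, \<pi>) \<and> X \<subseteq> G)"
      using True by (intro arg_cong[where f = Pr]) (auto simp: Q_def fun_eq_iff)
    also have "\<dots> \<le> p ^ card X * Pr (\<lambda>G. bfs r v G = (B, \<pi>))"
      using True by (intro Pr_remove bfs_remove) auto
    finally show ?thesis .
  next
    case False
    then have "Pr (Q X) = 0" by (intro Pr_impossible) (auto simp: Q_def)
    then show ?thesis using p_bounds Pr_nonneg by simp
  qed
  have "Pr (\<lambda>G. bfs r v G = (B, \<pi>) \<and> \<not> col_on (adj G) B 3) \<le>
      (\<Sum>l=1..card B. Pr (\<lambda>G. \<exists>A\<in>\<A> l. \<exists>X\<in>\<X> A. Q X G))"
  proof (rule Pr_union)
    fix G assume G: "G \<subseteq> edges V" "bfs r v G = (B, \<pi>) \<and> \<not> col_on (adj G) B 3"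
    obtain A X where AX: "A \<subseteq> B" "A \<noteq> {}" "X \<subseteq> spokes \<pi> r A" "card X = card A" "X \<subseteq> G"
      "\<And>y. y \<in> B \<Longrightarrow> {y, \<pi> y} \<notin> X"
      using non_three_colorable_witness[of r v G B \<pi>] G irrefl_adj[OF G(1)] B by metis
    have "A \<in> \<A> (card A)" "X \<in> \<X> A" "Q X G" using AX G(2) by (auto simp: \<A>_def \<X>_def Q_def)
    moreover have "card A \<in> {1..card B}"
      using AX(1,2) B by (simp add: card_mono Suc_le_eq card_gt_0_iff finite_subset)
    ultimately show "\<exists>l\<in>{1..card B}. \<exists>A\<in>\<A> l. \<exists>X\<in>\<X> A. Q X G" by blast
  qed simp
  also have "\<dots> \<le> (\<Sum>l=1..card B. (9 * (real r + 1) * real (card B) * p) ^ l * Pr (\<lambda>G. bfs r v G = (B, \<pi>)))"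
  proof (rule sum_mono)
    fix l
    have "Pr (\<lambda>G. \<exists>A\<in>\<A> l. \<exists>X\<in>\<X> A. Q X G) \<le> (\<Sum>A\<in>\<A> l. Pr (\<lambda>G. \<exists>X\<in>\<X> A. Q X G))"
      by (rule Pr_union) (use B in \<open>auto simp: \<A>_def\<close>)
    also have "\<dots> \<le> (\<Sum>A\<in>\<A> l. \<Sum>X\<in>\<X> A. Pr (Q X))"
      by (intro sum_mono Pr_union) (use fX in auto)
    also have "\<dots> \<le> (\<Sum>A\<in>\<A> l. \<Sum>X\<in>\<X> A. p ^ l * Pr (\<lambda>G. bfs r v G = (B, \<pi>)))"
    proof (intro sum_mono)
      fix A X assume "A \<in> \<A> l" "X \<in> \<X> A"
      then have "card X = l" by (simp add: \<A>_def \<X>_def)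
      then show "Pr (Q X) \<le> p ^ l * Pr (\<lambda>G. bfs r v G = (B, \<pi>))" using PrQ[of X] by simp
    qed
    also have "\<dots> = (\<Sum>A\<in>\<A> l. real (card (\<X> A)) * (p ^ l * Pr (\<lambda>G. bfs r v G = (B, \<pi>))))" by simp
    also have "\<dots> \<le> (\<Sum>A\<in>\<A> l. real (((r + 1) * l\<^sup>2) choose l) * (p ^ l * Pr (\<lambda>G. bfs r v G = (B, \<pi>))))"
    proof (intro sum_mono mult_right_mono)
      fix A assume A: "A \<in> \<A> l"
      then have l: "card A = l" by (simp add: \<A>_def)
      have "card (\<X> A) = card (spokes \<pi> r A) choose l"
        unfolding \<X>_def l by (rule n_subsets[OF finite_spokes[OF fA[OF A]]])
      also have "\<dots> \<le> ((r + 1) * l\<^sup>2) choose l"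
        using card_spokes[OF fA[OF A], of \<pi> r] by (intro binomial_right_mono) (simp add: l)
      finally show "real (card (\<X> A)) \<le> real (((r + 1) * l\<^sup>2) choose l)" by simp
    qed (use p_bounds Pr_nonneg in auto)
    also have "\<dots> = (real (card B choose l) * real (((r + 1) * l\<^sup>2) choose l) * p ^ l) *
        Pr (\<lambda>G. bfs r v G = (B, \<pi>))"
      using n_subsets[OF B, of l] by (simp add: \<A>_def)
    also have "\<dots> \<le> (9 * (real r + 1) * real (card B) * p) ^ l * Pr (\<lambda>G. bfs r v G = (B, \<pi>))"
      using p_bounds by (intro mult_right_mono witness_count_bound Pr_nonneg) auto
    finally show "Pr (\<lambda>G. \<exists>A\<in>\<A> l. \<exists>X\<in>\<X> A. Q X G) \<le>
      (9 * (real r + 1) * real (card B) * p) ^ l * Pr (\<lambda>G. bfs r v G = (B, \<pi>))" .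
  qed
  finally show ?thesis by (simp add: sum_distrib_right)
qed

lemma card_as_sum:
  assumes "finite A"
  shows "(\<Sum>x\<in>A. of_bool (Q x)) = real (card {x \<in> A. Q x})"
proof -
  have "(\<Sum>x\<in>A. of_bool (Q x)) = (\<Sum>x\<in>A. if Q x then 1 else (0::real))"
    by (intro sum.cong) auto
  also have "\<dots> = real (card {x \<in> A. Q x})"
    using assms by (simp add: sum.inter_filter[symmetric])
  finally show ?thesis .
qed

text \<open>
  A new vertex \<open>y\<close> is attached to the ball by an edge from some \<open>x\<close> in it. Given that \<open>x\<close> lies in the ball
  and \<open>y\<close> does not, this edge is present with probability at most \<open>p\<close>.
\<close>

lemma E_card_nball_Suc:
  assumes v: "v \<in> V"
  shows "E (\<lambda>G. real (card (nball (adj G) (Suc i) v))) \<le>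
    (1 + n * p) * E (\<lambda>G. real (card (nball (adj G) i v)))"
proof -
  define b where "b G = nball (adj G) i v" for G
  define Q where "Q z G \<longleftrightarrow> fst z \<in> b G \<and> snd z \<notin> b G" for z G
  define e where "e z = {fst z, snd z}" for z :: "nat \<times> nat"
  have bV: "b G \<subseteq> V" if "G \<subseteq> edges V" for G
    unfolding b_def using nball_subset_vertices[OF that v] .
  have "E (\<lambda>G. real (card (nball (adj G) (Suc i) v))) \<le>
      E (\<lambda>G. real (card (b G)) + (\<Sum>z\<in>V \<times> V. of_bool (Q z G \<and> e z \<in> G)))"
  proof (rule E_mono)
    fix G assume G: "G \<subseteq> edges V"
    let ?Z = "{z \<in> V \<times> V. Q z G \<and> e z \<in> G}"
    have fin: "finite (b G)" "finite ?Z" using bV[OF G] finite_V finite_subset by auto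
    have "nball (adj G) (Suc i) v \<subseteq> b G \<union> snd ` ?Z"
    proof
      fix y assume y: "y \<in> nball (adj G) (Suc i) v"
      show "y \<in> b G \<union> snd ` ?Z"
      proof (cases "y \<in> b G")
        case False
        then obtain x where x: "x \<in> b G" "{x, y} \<in> G"
          using y by (auto simp: nball_Suc adj_def b_def)
        have "(x, y) \<in> ?Z"
          using x False G doubleton_in_edges[of x y V] by (auto simp: Q_def e_def)
        then show ?thesis by force
      qed simp
    qed
    then have "card (nball (adj G) (Suc i) v) \<le> card (b G \<union> snd ` ?Z)"
      using fin by (intro card_mono) auto
    also have "\<dots> \<le> card (b G) + card (snd ` ?Z)" by (rule card_Un_le)
    also have "\<dots> \<le> card (b G) + card ?Z" using fin by (simp add: card_image_le)
    finally show "real (card (nball (adj G) (Suc i) v)) \<le>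
        real (card (b G)) + (\<Sum>z\<in>V \<times> V. of_bool (Q z G \<and> e z \<in> G))"
      by (subst card_as_sum) (use finite_V in auto)
  qed
  also have "\<dots> = E (\<lambda>G. real (card (b G))) + (\<Sum>z\<in>V \<times> V. Pr (\<lambda>G. Q z G \<and> e z \<in> G))"
    by (simp add: E_add E_sum prb_def)
  also have "(\<Sum>z\<in>V \<times> V. Pr (\<lambda>G. Q z G \<and> e z \<in> G)) \<le> (\<Sum>z\<in>V \<times> V. p * Pr (\<lambda>G. fst z \<in> b G))"
  proof (rule sum_mono)
    fix z
    show "Pr (\<lambda>G. Q z G \<and> e z \<in> G) \<le> p * Pr (\<lambda>G. fst z \<in> b G)"
    proof (cases "e z \<in> edges V")
      case True
      have "Pr (\<lambda>G. Q z G \<and> e z \<in> G) \<le> p * Pr (Q z)"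
      proof (rule Pr_remove_one[OF True])
        fix G assume "G \<subseteq> edges V" "Q z G"
        then show "Q z (G - {e z})"
          using nball_remove_exit[of "snd z" G i v i "fst z"] by (auto simp: Q_def b_def e_def)
      qed
      also have "\<dots> \<le> p * Pr (\<lambda>G. fst z \<in> b G)"
        using p_bounds by (intro mult_left_mono Pr_mono) (auto simp: Q_def)
      finally show ?thesis .
    next
      case False
      then have "Pr (\<lambda>G. Q z G \<and> e z \<in> G) = 0" by (intro Pr_impossible) auto
      then show ?thesis using p_bounds Pr_nonneg by simp
    qed
  qed
  also have "(\<Sum>z\<in>V \<times> V. p * Pr (\<lambda>G. fst z \<in> b G)) = (\<Sum>x\<in>V. \<Sum>y\<in>V. p * Pr (\<lambda>G. x \<in> b G))"
    unfolding sum.cartesian_product by (simp add: split_beta)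
  also have "\<dots> = n * p * (\<Sum>x\<in>V. Pr (\<lambda>G. x \<in> b G))"
    by (simp add: sum_distrib_left mult.assoc)
  also have "(\<Sum>x\<in>V. Pr (\<lambda>G. x \<in> b G)) = E (\<lambda>G. real (card (b G)))"
  proof -
    have "(\<Sum>x\<in>V. Pr (\<lambda>G. x \<in> b G)) = E (\<lambda>G. \<Sum>x\<in>V. of_bool (x \<in> b G))"
      by (simp add: prb_def E_sum)
    also have "\<dots> = E (\<lambda>G. real (card (b G)))"
    proof (rule E_cong)
      fix G assume "G \<subseteq> edges V"
      then have "{x \<in> V. x \<in> b G} = b G" using bV by auto
      then show "(\<Sum>x\<in>V. of_bool (x \<in> b G)) = real (card (b G))"
        by (simp only: card_as_sum[OF finite_V])
    qed
    finally show ?thesis .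
  qed
  finally show ?thesis by (simp add: b_def algebra_simps)
qed

lemma E_card_nball:
  assumes "v \<in> V"
  shows "E (\<lambda>G. real (card (nball (adj G) i v))) \<le> (1 + n * p) ^ i"
proof (induction i)
  case (Suc i)
  have "E (\<lambda>G. real (card (nball (adj G) (Suc i) v))) \<le> (1 + n * p) * (1 + n * p) ^ i"
    by (rule order_trans[OF E_card_nball_Suc[OF assms]])
      (use Suc p_bounds in \<open>auto intro!: mult_left_mono\<close>)
  then show ?case by simp
qed (simp add: E_const)

text \<open>
  By Markov's inequality the ball has at least \<open>N\<close> vertices with probability at most \<open>1/8\<close>; a smaller
  ball is not \<open>3\<close>-colorable with probability at most \<open>1/9 + 1/9^2 + \<dots> = 1/8\<close>.
\<close>

lemma Pr_ball_not_three_colorable: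
  assumes v: "v \<in> V" and N: "8 * (1 + n * p) ^ r \<le> N" "9 * (real r + 1) * N * p \<le> 1 / 9"
  shows "Pr (\<lambda>G. \<not> col_on (adj G) (nball (adj G) r v) 3) \<le> 1 / 4"
proof -
  have Npos: "N > 0"
    using N(1) p_bounds by (smt (verit) mult_nonneg_nonneg of_nat_0_le_iff zero_less_power)
  define small where "small G \<longleftrightarrow> real (card (fst (bfs r v G))) \<le> N" for G
  define bad where "bad G \<longleftrightarrow> small G \<and> \<not> col_on (adj G) (fst (bfs r v G)) 3" for G
  have "Pr (\<lambda>G. real (card (nball (adj G) r v)) \<ge> N) \<le>
      E (\<lambda>G. real (card (nball (adj G) r v))) / N"
    by (rule Markov) (use Npos in auto)
  also have "\<dots> \<le> 1 / 8"
    using E_card_nball[OF v, of r] N(1) Npos by (simp add: field_simps)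
  finally have large: "Pr (\<lambda>G. real (card (nball (adj G) r v)) \<ge> N) \<le> 1 / 8" .
  have "Pr (\<lambda>G. bfs r v G = t \<and> bad G) \<le> 1 / 8 * Pr (\<lambda>G. bfs r v G = t)" for t
  proof -
    obtain B \<pi> where t: "t = (B, \<pi>)" by force
    show ?thesis
    proof (cases "B \<subseteq> V \<and> real (card B) \<le> N")
      case True
      then have finB: "finite B" using finite_V finite_subset by blast
      have "Pr (\<lambda>G. bfs r v G = t \<and> bad G) \<le>
          Pr (\<lambda>G. bfs r v G = (B, \<pi>) \<and> \<not> col_on (adj G) B 3)"
        by (intro Pr_mono) (auto simp: t bad_def)
      also have "\<dots> \<le> (\<Sum>l=1..card B. (9 * (real r + 1) * real (card B) * p) ^ l) *
          Pr (\<lambda>G. bfs r v G = (B, \<pi>))"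
        by (rule Pr_not_three_colorable_given_bfs[OF finB])
      also have "\<dots> \<le> 1 / 8 * Pr (\<lambda>G. bfs r v G = (B, \<pi>))"
      proof (intro mult_right_mono geometric_ninth Pr_nonneg)
        have "9 * (real r + 1) * real (card B) * p \<le> 9 * (real r + 1) * N * p"
          using True p_bounds by (intro mult_right_mono mult_left_mono) auto
        then show "9 * (real r + 1) * real (card B) * p \<le> 1 / 9" using N(2) by linarith
      qed (use p_bounds in simp)
      finally show ?thesis by (simp add: t)
    next
      case False
      have "Pr (\<lambda>G. bfs r v G = t \<and> bad G) = 0"
      proof (rule Pr_impossible)
        fix G assume "G \<subseteq> edges V"
        then show "\<not> (bfs r v G = t \<and> bad G)"
          using False nball_subset_vertices[of G V v r] v
          by (auto simp: bad_def small_def t bfs_def)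
      qed
      then show ?thesis using Pr_nonneg by simp
    qed
  qed
  then have "Pr bad \<le> 1 / 8" by (rule Pr_partition)
  moreover have "Pr (\<lambda>G. \<not> col_on (adj G) (nball (adj G) r v) 3) \<le>
      (\<Sum>i\<in>{True, False}. Pr (if i then \<lambda>G. real (card (nball (adj G) r v)) \<ge> N else bad))"
    by (rule Pr_union) (auto simp: bad_def small_def bfs_def)
  ultimately show ?thesis using large by simp
qed

lemma Pr_large_independent_set:
  assumes n: "card V \<ge> 3" and q: "p * real q \<ge> 4 * ln n"
  shows "Pr (\<lambda>G. \<exists>S\<subseteq>V. card S = Suc q \<and> G \<inter> edges S = {}) < 1 / 2"
proof -
  have n0: "n > 0" using n by simp
  have "Pr (\<lambda>G. \<exists>S\<subseteq>V. card S = Suc q \<and> G \<inter> edges S = {}) \<le>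
      (\<Sum>S\<in>{S. S \<subseteq> V \<and> card S = Suc q}. Pr (\<lambda>G. G \<inter> edges S = {}))"
    by (rule Pr_union) (use finite_V in auto)
  also have "\<dots> \<le> (\<Sum>S\<in>{S. S \<subseteq> V \<and> card S = Suc q}. (1 - p) ^ (Suc q choose 2))"
  proof (rule sum_mono)
    fix S assume S: "S \<in> {S. S \<subseteq> V \<and> card S = Suc q}"
    then have "finite S" using finite_V finite_subset by auto
    moreover have "edges S \<subseteq> edges V" using S by (auto simp: edges_def)
    ultimately show "Pr (\<lambda>G. G \<inter> edges S = {}) \<le> (1 - p) ^ (Suc q choose 2)"
      using Pr_avoid[of "edges S"] card_edges[of S] S by simp
  qed
  also have "\<dots> = real (card V choose Suc q) * (1 - p) ^ (Suc q choose 2)"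
    using n_subsets[OF finite_V, of "Suc q"] by simp
  also have "\<dots> \<le> n ^ Suc q * exp (- p * real (Suc q choose 2))"
  proof (rule mult_mono)
    show "real (card V choose Suc q) \<le> n ^ Suc q"
      using binomial_fact_pow[of "card V" "Suc q"] fact_ge_1[of "Suc q", where 'a = nat]
      by (metis (no_types, opaque_lifting) le_trans mult.right_neutral mult_le_mono2 of_nat_le_iff of_nat_power)
    have "(1 - p) ^ (Suc q choose 2) \<le> exp (- p) ^ (Suc q choose 2)"
      using p_bounds exp_ge_add_one_self[of "- p"] by (intro power_mono) auto
    then show "(1 - p) ^ (Suc q choose 2) \<le> exp (- p * real (Suc q choose 2))"
      by (simp add: exp_of_nat_mult[symmetric] mult.commute)
  qed (use p_bounds in auto)
  also have "real (Suc q choose 2) = real (Suc q) * (real q / 2)"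
  proof -
    have "2 * (Suc q choose 2) = Suc q * q" using choose_two[of "Suc q"] by simp
    then have "2 * real (Suc q choose 2) = real (Suc q) * real q"
      by (metis of_nat_mult of_nat_numeral)
    then show ?thesis by simp
  qed
  also have "exp (- p * (real (Suc q) * (real q / 2))) = exp (- p * real q / 2) ^ Suc q"
    unfolding exp_of_nat_mult[symmetric] by (rule arg_cong[where f = exp]) simp
  also have "n ^ Suc q * exp (- p * real q / 2) ^ Suc q = (n * exp (- p * real q / 2)) ^ Suc q"
    by (simp only: power_mult_distrib)
  also have "\<dots> \<le> (1 / n) ^ Suc q"
  proof (rule power_mono)
    have "exp (- p * real q / 2) \<le> exp (- (2 * ln n))" using q by simp
    also have "\<dots> = 1 / n\<^sup>2"
      using n0 by (simp add: exp_minus exp_double divide_inverse)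
    finally have "n * exp (- p * real q / 2) \<le> n * (1 / n\<^sup>2)"
      using n0 by (intro mult_left_mono) auto
    then show "n * exp (- p * real q / 2) \<le> 1 / n" using n0 by (simp add: power2_eq_square)
  qed simp
  also have "\<dots> \<le> (1 / n) ^ 1" by (rule power_decreasing) (use n in auto)
  also have "\<dots> < 1 / 2" using n by simp
  finally show ?thesis .
qed

text \<open>
  The expected number of vertices whose ball is not \<open>3\<close>-colorable is at most \<open>n / 4\<close>, so by Markov's
  inequality there are \<open>n / 2\<close> or more of them with probability at most \<open>1/2\<close>.
\<close>

lemma exists_locally_three_colorable:
  assumes n: "card V \<ge> 3"
    and N: "8 * (1 + n * p) ^ r \<le> N" "9 * (real r + 1) * N * p \<le> 1 / 9"
    and q: "p * real q \<ge> 4 * ln n"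
  obtains G where "G \<subseteq> edges V"
    "n < 2 * real (card {v \<in> V. col_on (adj G) (nball (adj G) r v) 3})"
    "\<And>S. S \<subseteq> V \<Longrightarrow> G \<inter> edges S = {} \<Longrightarrow> card S \<le> q"
proof -
  define bad where "bad G = {v \<in> V. \<not> col_on (adj G) (nball (adj G) r v) 3}" for G
  define ind where "ind G \<longleftrightarrow> (\<exists>S\<subseteq>V. card S = Suc q \<and> G \<inter> edges S = {})" for G
  have "E (\<lambda>G. real (card (bad G))) =
      (\<Sum>v\<in>V. Pr (\<lambda>G. \<not> col_on (adj G) (nball (adj G) r v) 3))"
    unfolding prb_def E_sum[symmetric] bad_def card_as_sum[OF finite_V] ..
  also have "\<dots> \<le> (\<Sum>v\<in>V. 1 / 4)"
    by (intro sum_mono Pr_ball_not_three_colorable[OF _ N])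
  finally have Ebad: "E (\<lambda>G. real (card (bad G))) \<le> n / 4" by simp
  have "Pr (\<lambda>G. real (card (bad G)) \<ge> n / 2) \<le> E (\<lambda>G. real (card (bad G))) / (n / 2)"
    by (rule Markov) (use n in auto)
  also have "\<dots> \<le> (n / 4) / (n / 2)" using Ebad by (intro divide_right_mono) auto
  also have "\<dots> = 1 / 2" using n by (simp add: field_simps)
  finally have 1: "Pr (\<lambda>G. real (card (bad G)) \<ge> n / 2) \<le> 1 / 2" .
  have 2: "Pr ind < 1 / 2" unfolding ind_def by (rule Pr_large_independent_set[OF n q])
  have "Pr (\<lambda>G. real (card (bad G)) \<ge> n / 2 \<or> ind G) \<le>
      (\<Sum>i\<in>{True, False}. Pr (if i then \<lambda>G. real (card (bad G)) \<ge> n / 2 else ind))"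
    by (rule Pr_union) auto
  then have "Pr (\<lambda>G. real (card (bad G)) \<ge> n / 2 \<or> ind G) < 1" using 1 2 by simp
  then obtain G where G: "G \<subseteq> edges V" "\<not> (real (card (bad G)) \<ge> n / 2 \<or> ind G)"
    by (rule Pr_less_1_obtains)
  let ?good = "{v \<in> V. col_on (adj G) (nball (adj G) r v) 3}"
  have "V = ?good \<union> bad G" "?good \<inter> bad G = {}" by (auto simp: bad_def)
  moreover have "finite ?good" "finite (bad G)" using finite_V by (auto simp: bad_def)
  ultimately have "card V = card ?good + card (bad G)" by (metis card_Un_disjoint)
  then have "n < 2 * real (card ?good)" using G(2) by simp
  moreover have "card S \<le> q" if S: "S \<subseteq> V" "G \<inter> edges S = {}" for S
  proof (rule ccontr)
    assume "\<not> card S \<le> q"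
    then obtain T where T: "T \<subseteq> S" "card T = Suc q"
      using obtain_subset_with_card_n[of "Suc q" S] by auto
    then have "G \<inter> edges T = {}" using S(2) by (auto simp: edges_def)
    then show False using G(2) T S(1) unfolding ind_def by blast
  qed
  ultimately show thesis using that G(1) by blast
qed

end

section \<open>The lower bound\<close>

lemma col_on_chromatic_number:
  assumes "pair_graph G"
  shows "col_on (parcs G) (pverts G) (chromatic_number (with_proj G))"
  unfolding chromatic_number_def colorable_iff_col_on[OF assms, symmetric]
  using colorable_card[OF assms] by (rule LeastI)

lemma card_le_colors_times_independent:
  assumes "finite D" "col_on R D k"
    "\<And>S. S \<subseteq> D \<Longrightarrow> R \<inter> S \<times> S = {} \<Longrightarrow> card S \<le> q"
  shows "card D \<le> k * q"
proof -
  obtain f where f: "f ` D \<subseteq> {..<k}" "\<forall>x\<in>D. \<forall>y\<in>D. (x, y) \<in> R \<longrightarrow> f x \<noteq> f y"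
    using assms(2) by (rule col_onE)
  have "D = (\<Union>j<k. {x \<in> D. f x = j})" using f(1) by auto
  then have "card D \<le> (\<Sum>j<k. card {x \<in> D. f x = j})"
    using card_UN_le[of "{..<k}" "\<lambda>j. {x \<in> D. f x = j}"] by simp
  also have "\<dots> \<le> (\<Sum>j<k. q)"
    by (intro sum_mono assms(3)) (use f(2) in fastforce)+
  finally show ?thesis by simp
qed

text \<open>
  Alteration: all edges at vertices outside \<open>D\<close>, the set of vertices with a \<open>3\<close>-colorable ball, are
  deleted. This only shrinks the balls around the vertices of \<open>D\<close>, and the independent sets inside \<open>D\<close>
  stay the same.
\<close>

lemma max_chromatic_ge_from_random_graph:
  fixes p :: real
  assumes c: "c \<ge> 3" and n: "n \<ge> 3" and p: "0 < p" "p < 1"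
    and N: "8 * (1 + real n * p) ^ r \<le> N" "9 * (real r + 1) * N * p \<le> 1 / 9"
    and q: "p * real q \<ge> 4 * ln (real n)"
  shows "real n < 2 * real (max_chromatic c r n) * real q"
proof -
  interpret random_graph "{..<n}" p using p by unfold_locales auto
  obtain G where G: "G \<subseteq> edges {..<n}"
    "real n < 2 * real (card {v \<in> {..<n}. col_on (adj G) (nball (adj G) r v) 3})"
    "\<And>S. S \<subseteq> {..<n} \<Longrightarrow> G \<inter> edges S = {} \<Longrightarrow> card S \<le> q"
    using exists_locally_three_colorable[of r N q] n N q by auto
  define D where "D = {v \<in> {..<n}. col_on (adj G) (nball (adj G) r v) 3}"
  define H where "H = \<lparr>pverts = {..<n}, parcs = adj G \<inter> D \<times> D\<rparr>"
  have adjG: "x < n \<and> y < n \<and> x \<noteq> y" if "(x, y) \<in> adj G" for x y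
    using that G(1) doubleton_in_edges[of x y "{..<n}"] by (auto simp: adj_def)
  have H: "pair_graph H"
  proof unfold_locales
    show "symmetric (with_proj H)"
      unfolding symmetric_def
      using sym_adj[of G] by (auto simp: H_def sym_def)
    show "finite (parcs H)"
      by (rule finite_subset[of _ "{..<n} \<times> {..<n}"]) (auto simp: H_def D_def)
  qed (use adjG in \<open>auto simp: H_def\<close>)
  have loc: "locally_colorable c r (with_proj H)"
    unfolding locally_colorable_iff[OF H]
  proof
    fix v assume "v \<in> pverts H"
    show "col_on (parcs H) (nball (parcs H) r v) c"
    proof (cases "v \<in> D")
      case True
      have sub: "parcs H \<subseteq> adj G" by (auto simp: H_def)
      have "col_on (adj G) (nball (adj G) r v) 3" using True by (simp add: D_def)
      then show ?thesis
        by (rule col_on_mono[OF _ nball_mono[OF sub order_refl] _ c]) (use sub in blast)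
    next
      case False
      have "parcs H `` {v} = {}" using False by (auto simp: H_def)
      then have "nball (parcs H) i v = {v}" for i by (induction i) (simp_all add: nball_Suc)
      moreover have "(v, v) \<notin> parcs H" using False by (auto simp: H_def)
      ultimately show ?thesis using c unfolding col_on_def by (intro exI[of _ "\<lambda>_. 0"]) auto
    qed
  qed
  let ?k = "chromatic_number (with_proj H)"
  have "col_on (parcs H) (pverts H) ?k" using H by (rule col_on_chromatic_number)
  then have "col_on (adj G) D ?k"
    by (rule col_on_mono) (auto simp: H_def D_def)
  then have "card D \<le> ?k * q"
  proof (rule card_le_colors_times_independent[rotated])
    fix S assume S: "S \<subseteq> D" "adj G \<inter> S \<times> S = {}"
    have "e \<notin> edges S" if "e \<in> G" for e
    proof
      assume "e \<in> edges S"
      then obtain x y where "e = {x, y}" "x \<in> S" "y \<in> S" by (auto simp: edges_def card_2_iff)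
      then show False using S(2) that by (auto simp: adj_def)
    qed
    then show "card S \<le> q" using S(1) by (intro G(3)) (auto simp: D_def)
  qed (simp add: D_def)
  moreover have "?k \<le> max_chromatic c r n"
    using chromatic_number_le_max[OF H loc] by (simp add: H_def)
  ultimately have "card D \<le> max_chromatic c r n * q" by (meson le_trans mult_le_mono1)
  then have "real (card D) \<le> real (max_chromatic c r n) * real q"
    by (metis of_nat_le_iff of_nat_mult)
  then show ?thesis using G(2) by (simp add: D_def)
qed

text \<open>
  The factor \<open>1/1296 = 1/2 \<cdot> 1/2 \<cdot> 1/324\<close> in the average degree \<open>d\<close> does not depend on \<open>r\<close>. One half
  absorbs the factor \<open>2^r\<close> from \<open>1 + d \<le> 2 d\<close>, the other one the factor
  \<open>r + 1 \<le> 2^(r+1)\<close>, and what remains is \<open>36 / 324 = 1/9\<close>.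
\<close>

lemma density_power_bound:
  fixes d :: real
  assumes "d \<ge> 0" "d ^ Suc r = (1 / 1296) ^ Suc r * real n" "n > 0"
  shows "9 * (real r + 1) * (8 * (2 * d) ^ r) * (d / real n) \<le> 1 / 9"
proof -
  have "9 * (real r + 1) * (8 * (2 * d) ^ r) * (d / real n) =
      36 * (real r + 1) * (2 ^ Suc r * d ^ Suc r) / real n"
    by (simp add: power_mult_distrib)
  also have "\<dots> = 36 * (real r + 1) * (2 * (1 / 1296)) ^ Suc r"
    unfolding assms(2) power_mult_distrib using assms(3) by simp
  also have "\<dots> = 36 * ((real r + 1) / 2 ^ Suc r) * (1 / 324) ^ Suc r"
  proof -
    have "(2 * (1 / 1296) :: real) ^ Suc r = (1 / 2 * (1 / 324)) ^ Suc r" by simp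
    also have "\<dots> = (1 / 2) ^ Suc r * (1 / 324) ^ Suc r" by (rule power_mult_distrib)
    also have "(1 / 2 :: real) ^ Suc r = 1 / 2 ^ Suc r" by (rule power_one_over)
    finally have eq: "(2 * (1 / 1296) :: real) ^ Suc r = 1 / 2 ^ Suc r * (1 / 324) ^ Suc r" .
    show ?thesis unfolding eq by (simp only: times_divide_eq_left times_divide_eq_right mult_1 mult_1_right mult.assoc)
  qed
  also have "\<dots> \<le> 36 * 1 * (1 / 324)"
  proof (rule mult_mono)
    have "real (Suc r) < 2 ^ Suc r" by (rule of_nat_less_two_power)
    then show "36 * ((real r + 1) / 2 ^ Suc r) \<le> 36 * 1" by (simp add: field_simps)
    show "(1 / 324) ^ Suc r \<le> (1 / 324 :: real)"
      using power_decreasing[of 1 "Suc r" "1 / 324 :: real"] by simp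
  qed simp_all
  finally show ?thesis by simp
qed

lemma max_chromatic_lower:
  assumes c: "c \<ge> 3" and n: "n \<ge> 3"
    and large: "real n powr (1 / (real r + 1)) \<ge> 1296"
  shows "1 / 12960 * (real n powr (1 / (real r + 1)) / ln (real n)) \<le> real (max_chromatic c r n)"
proof -
  define x where "x = real n powr (1 / (real r + 1))"
  define d where "d = x / 1296"
  define p where "p = d / real n"
  define q where "q = nat \<lceil>4 * ln (real n) / p\<rceil>"
  have d1: "d \<ge> 1" using large by (simp add: d_def x_def)
  have xn: "x ^ Suc r = real n" unfolding x_def by (rule powr_root_power) simp
  have dn: "d ^ Suc r = (1 / 1296) ^ Suc r * real n"
    unfolding xn[symmetric] by (simp add: d_def power_divide)
  have "x \<le> real n"
    unfolding x_def using powr_mono[of "1 / (real r + 1)" 1 "real n"] n by simp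
  then have "d < real n" using n by (simp add: d_def)
  then have p: "0 < p" "p < 1" using d1 n by (auto simp: p_def)
  have ln1: "ln (real n) \<ge> 1"
  proof -
    have "exp 1 \<le> real n" using exp_le n by linarith
    then show ?thesis using n by (simp add: ln_ge_iff)
  qed
  have np: "real n * p = d" using n by (simp add: p_def)
  have "real n < 2 * real (max_chromatic c r n) * real q"
  proof (rule max_chromatic_ge_from_random_graph[OF c n p])
    show "8 * (1 + real n * p) ^ r \<le> 8 * (2 * d) ^ r"
      unfolding np using d1 by (intro mult_left_mono power_mono) auto
    show "9 * (real r + 1) * (8 * (2 * d) ^ r) * p \<le> 1 / 9"
      unfolding p_def using d1 dn n by (intro density_power_bound) auto
    have "4 * ln (real n) / p \<le> real q" unfolding q_def by linarith
    then show "p * real q \<ge> 4 * ln (real n)" using p by (simp add: field_simps)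
  qed
  moreover have "p * real q \<le> 5 * ln (real n)"
  proof -
    have "4 * ln (real n) / p \<ge> 0" using p ln1 by auto
    then have "real q \<le> 4 * ln (real n) / p + 1" unfolding q_def by linarith
    then have "p * real q \<le> p * (4 * ln (real n) / p + 1)" using p by (intro mult_left_mono) auto
    also have "\<dots> = 4 * ln (real n) + p" using p by (simp add: field_simps)
    finally show ?thesis using p ln1 by linarith
  qed
  ultimately have "real n * p \<le> 2 * real (max_chromatic c r n) * (5 * ln (real n))"
    using p by (smt (verit) mult.assoc mult.commute mult_left_mono mult_right_mono of_nat_0_le_iff)
  then have "x / 1296 \<le> 10 * ln (real n) * real (max_chromatic c r n)"
    unfolding np by (simp add: d_def mult_ac)
  then show ?thesis using ln1 unfolding x_def[symmetric] by (simp add: field_simps)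
qed

theorem mainTheorem1:
  shows "\<exists>a::real. a > 0 \<and>
    (\<exists>b :: nat \<Rightarrow> nat \<Rightarrow> real.
      (\<forall>c\<ge>3. \<forall>r\<ge>1. b c r > 0) \<and>
      (\<forall>c\<ge>3. \<forall>r\<ge>1. \<forall>\<^sub>F n in sequentially.
        a * (real n powr (1 / (real r + 1)) / ln (real n)) \<le> real (max_chromatic c r n) \<and>
        real (max_chromatic c r n) \<le> b c r * real n powr (1 / (real r + 1))))"
proof (intro exI conjI allI impI)
  fix c r :: nat
  assume c: "c \<ge> 3" and r: "r \<ge> 1"
  have "real n powr (1 / (real r + 1)) \<ge> 1296" if "n \<ge> 1296 ^ Suc r" for n
  proof (rule power_le_imp_le_base)
    have "real n \<ge> real (1296 ^ Suc r)" using that unfolding of_nat_le_iff .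
    then show "1296 ^ Suc r \<le> (real n powr (1 / (real r + 1))) ^ Suc r"
      unfolding powr_root_power[OF of_nat_0_le_iff] by simp
  qed simp
  then have "\<forall>\<^sub>F n in sequentially. real n powr (1 / (real r + 1)) \<ge> 1296"
    unfolding eventually_sequentially by blast
  then show "\<forall>\<^sub>F n in sequentially.
      1 / 12960 * (real n powr (1 / (real r + 1)) / ln (real n)) \<le> real (max_chromatic c r n) \<and>
      real (max_chromatic c r n) \<le>
        real c * (real r + 1) * real n powr (1 / (real r + 1))"
    using eventually_ge_at_top[of 3]
  proof eventually_elim
    case (elim n)
    then show ?case using max_chromatic_lower[OF c] max_chromatic_upper[of c] c by simp
  qed
qed auto

end
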